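(* Let $G$ be a simple, simply connected algebraic group over $\mathbb{C}$ of rank $n$, with maximal torus $T$, and let $V_\lambda$ be an irreducible representation of $G$ of highest weight $\lambda$ such that $\rho_\lambda:G\to \mathrm{Aut}(V_\lambda)$ has finite kernel. Let $\theta_\lambda:G\to\mathfrak{g}$ be the Springer morphism, and for $t\in T$ write $\theta_\lambda(t)=\sum_{i=1}^n c_i(t)\check{\alpha}_i$, where $\check\alpha_1,\dots,\check\alpha_n$ are the simple coroots. Then for every $t\in T$ the coefficients $c_1(t),\dots,c_n(t)$ are determined by (i.e. are the unique solution of) the system of equations $$\begin{pmatrix}\sum_{\mu\in\Lambda_\lambda}\mu_1\, e^\mu(t)\\ \vdots\\ \sum_{\mu\in\Lambda_\lambda}\mu_n\, e^\mu(t)\end{pmatrix}=S(G,\lambda)\begin{pmatrix}c_1(t)\\ \vdots\\ c_n(t)\end{pmatrix},$$ where $S(G,\lambda)$ is the $n\times n$ matrix with entries $S(G,\lambda)_{ij}=\sum_{\mu\in\Lambda_\lambda}\mu_i\mu_j$.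
   Context: $\mathfrak{g}$ is the Lie algebra of $G$, and $\mathfrak{t}\subset\mathfrak{g}$ is the Lie algebra of $T$ (a Cartan subalgebra). A base of simple roots $\alpha_1,\dots,\alpha_n$ is fixed, with simple coroots $\check\alpha_1,\dots,\check\alpha_n$ (a basis of $\mathfrak{t}$) and fundamental weights $\omega_1,\dots,\omega_n\in\mathfrak{t}^*$ defined by $\omega_i(\check\alpha_j)=\delta_{ij}$. $\Lambda_\lambda$ is the multiset of weights of $T$ on $V_\lambda$, each weight $\mu$ listed with multiplicity $\dim V_\mu$ (so sums over $\Lambda_\lambda$ are with multiplicity). Each weight is written $\mu=\mu_1\omega_1+\dots+\mu_n\omega_n$, so $\mu_i=\mu(\check\alpha_i)$, and $e^\mu:T\to\mathbb{C}^*$ is the corresponding character. Springer morphism: $\mathfrak{g}$ is regarded as a subspace of $\mathrm{End}(V_\lambda)$ via the (injective) derivative $d\rho_\lambda$. Let $\mathfrak{g}^\perp$ be the orthogonal complement of $\mathfrak{g}$ in $\mathrm{End}(V_\lambda)$ with respect to the form $\langle A,B\rangle=\mathrm{tr}(AB)$. Then $\mathrm{End}(V_\lambda)=\mathfrak{g}\oplus\mathfrak{g}^\perp$; let $\pi:\mathrm{End}(V_\lambda)\to\mathfrak{g}$ be the projection onto the first summand. The Springer morphism is $\theta_\lambda=\pi\circ\rho_\lambda:G\to\mathfrak{g}$. It is known that $\theta_\lambda(T)\subset\mathfrak{t}$, so the coefficients $c_i(t)\in\mathbb{C}$ are well defined. *)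

theory Defs
  imports "HOL-Analysis.Analysis" "HOL-Library.Multiset"
begin

text \<open>
  Affine algebraic groups over the complex numbers are realised as Zariski closed subgroups
  of some \<open>GL_N(\<complex>)\<close>; a representation space \<open>V\<close> is \<open>\<complex>^'v\<close>, so \<open>End(V)\<close> is a matrix space.
\<close>

subsection \<open>Algebraic groups\<close>

abbreviation GL :: "(complex^'N^'N) set"
  where "GL \<equiv> {A. invertible A}"

definition cscale :: "complex \<Rightarrow> complex^'N^'N \<Rightarrow> complex^'N^'N"
  where "cscale s X = (\<chi> i j. s * X$i$j)"

definition bracket :: "complex^'N^'N \<Rightarrow> complex^'N^'N \<Rightarrow> complex^'N^'N"
  where "bracket X Y = X ** Y - Y ** X"

inductive polyfun :: "(complex^'N^'N \<Rightarrow> complex) \<Rightarrow> bool" where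
  const: "polyfun (\<lambda>_. a)"
| entry: "polyfun (\<lambda>A. A$i$j)"
| add: "polyfun p \<Longrightarrow> polyfun q \<Longrightarrow> polyfun (\<lambda>A. p A + q A)"
| mult: "polyfun p \<Longrightarrow> polyfun q \<Longrightarrow> polyfun (\<lambda>A. p A * q A)"

definition zariski_closed :: "(complex^'N^'N) set \<Rightarrow> bool" where
  "zariski_closed S \<longleftrightarrow>
     (\<exists>P. (\<forall>p\<in>P. polyfun p) \<and> S = {g \<in> GL. \<forall>p\<in>P. p g = 0})"

definition zariski_connected :: "(complex^'N^'N) set \<Rightarrow> bool" where
  "zariski_connected S \<longleftrightarrow>
     (\<forall>A B. zariski_closed A \<and> zariski_closed B \<and> S \<subseteq> A \<union> B \<and> A \<inter> B \<inter> S = {}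
        \<longrightarrow> A \<inter> S = {} \<or> B \<inter> S = {})"

definition algebraic_group :: "(complex^'N^'N) set \<Rightarrow> bool" where
  "algebraic_group G \<longleftrightarrow> zariski_closed G \<and> mat 1 \<in> G \<and>
     (\<forall>g\<in>G. \<forall>h\<in>G. g ** h \<in> G) \<and> (\<forall>g\<in>G. matrix_inv g \<in> G)"

text \<open>
  As usual, a simple algebraic group may have a finite nontrivial centre.
\<close>

definition simple_algebraic_group :: "(complex^'N^'N) set \<Rightarrow> bool" where
  "simple_algebraic_group G \<longleftrightarrow> algebraic_group G \<and> zariski_connected G \<and>
     (\<exists>g\<in>G. \<exists>h\<in>G. g ** h \<noteq> h ** g) \<and>
     (\<forall>H. algebraic_group H \<and> zariski_connected H \<and> H \<subseteq> G \<and>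
          (\<forall>g\<in>G. \<forall>h\<in>H. g ** h ** matrix_inv g \<in> H)
        \<longrightarrow> H = {mat 1} \<or> H = G)"

definition regular_GL :: "(complex^'N^'N \<Rightarrow> complex) \<Rightarrow> bool" where
  "regular_GL F \<longleftrightarrow> (\<exists>p k. polyfun p \<and> (\<forall>g\<in>GL. F g = p g / det g ^ k))"

definition regular_on :: "(complex^'N^'N) set \<Rightarrow> (complex^'N^'N \<Rightarrow> complex) \<Rightarrow> bool" where
  "regular_on G f \<longleftrightarrow> (\<exists>F. regular_GL F \<and> (\<forall>g\<in>G. f g = F g))"

definition alg_hom ::
  "(complex^'N^'N) set \<Rightarrow> (complex^'M^'M) set \<Rightarrow> (complex^'N^'N \<Rightarrow> complex^'M^'M) \<Rightarrow> bool" where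
  "alg_hom G H \<phi> \<longleftrightarrow> (\<forall>g\<in>G. \<phi> g \<in> H) \<and> (\<forall>g\<in>G. \<forall>h\<in>G. \<phi> (g ** h) = \<phi> g ** \<phi> h) \<and>
     (\<forall>a b. regular_on G (\<lambda>g. \<phi> g $ a $ b))"

subsection \<open>Tori\<close>

text \<open>
  \<open>diag_torus I\<close> is the standard torus \<open>(\<complex>\<^sup>*)^I\<close>. A torus inside \<open>GL_N(\<complex>)\<close> has rank at
  most \<open>N\<close>, so index sets \<open>I\<close> of coordinates of \<open>\<complex>^N\<close> account for all ranks.
\<close>

definition diag_torus :: "'N set \<Rightarrow> (complex^'N^'N) set" where
  "diag_torus I = {d \<in> GL. (\<forall>i j. i \<noteq> j \<longrightarrow> d$i$j = 0) \<and> (\<forall>i. i \<notin> I \<longrightarrow> d$i$i = 1)}"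

definition torus_of_rank :: "nat \<Rightarrow> (complex^'N^'N) set \<Rightarrow> bool" where
  "torus_of_rank n T \<longleftrightarrow> algebraic_group T \<and>
     (\<exists>(I :: 'N set) \<phi> \<psi>. card I = n \<and>
        alg_hom T (diag_torus I) \<phi> \<and> alg_hom (diag_torus I) T \<psi> \<and>
        (\<forall>t\<in>T. \<psi> (\<phi> t) = t) \<and> (\<forall>d\<in>diag_torus I. \<phi> (\<psi> d) = d))"

definition maximal_torus :: "(complex^'N^'N) set \<Rightarrow> (complex^'N^'N) set \<Rightarrow> bool" where
  "maximal_torus G T \<longleftrightarrow> T \<subseteq> G \<and> (\<exists>n. torus_of_rank n T) \<and>
     (\<forall>T' n. torus_of_rank n T' \<and> T \<subseteq> T' \<and> T' \<subseteq> G \<longrightarrow> T' = T)"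

subsection \<open>Lie algebras and differentials\<close>

text \<open>
  The Zariski tangent space at the identity: the common zeros of the differentials at the identity
  of the polynomials vanishing on the group.
\<close>

definition lie_algebra :: "(complex^'N^'N) set \<Rightarrow> (complex^'N^'N) set" where
  "lie_algebra G = {X. \<forall>p. polyfun p \<and> (\<forall>g\<in>G. p g = 0)
     \<longrightarrow> deriv (\<lambda>s. p (mat 1 + cscale s X)) 0 = 0}"

text \<open>
  The differential at the identity of a regular function \<open>f\<close> on \<open>G\<close>. For \<open>X\<close> in the Lie algebra
  of \<open>G\<close> the value does not depend on the regular extension \<open>F\<close> of \<open>f\<close> to \<open>GL_N(\<complex>)\<close>.
\<close>

definition differential ::
  "(complex^'N^'N) set \<Rightarrow> (complex^'N^'N \<Rightarrow> complex) \<Rightarrow> complex^'N^'N \<Rightarrow> complex" where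
  "differential G f X =
     (THE d. \<exists>F. regular_GL F \<and> (\<forall>g\<in>G. f g = F g) \<and> d = deriv (\<lambda>s. F (mat 1 + cscale s X)) 0)"

definition rep_differential ::
  "(complex^'N^'N) set \<Rightarrow> (complex^'N^'N \<Rightarrow> complex^'v^'v) \<Rightarrow> complex^'N^'N \<Rightarrow> complex^'v^'v" where
  "rep_differential G \<rho> X = (\<chi> a b. differential G (\<lambda>g. \<rho> g $ a $ b) X)"

subsection \<open>Characters, roots and coroots\<close>

text \<open>
  A character \<open>\<mu>\<close> of \<open>T\<close> plays the role of \<open>e^\<mu>\<close>; the corresponding element of the dual of the
  Lie algebra of \<open>T\<close> is \<open>differential T \<mu>\<close>. Extensionality makes equality of characters the
  equality of their values on \<open>T\<close>.
\<close>

definition characters :: "(complex^'N^'N) set \<Rightarrow> (complex^'N^'N \<Rightarrow> complex) set" where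
  "characters T = {\<xi> \<in> extensional T. regular_on T \<xi> \<and> (\<forall>t\<in>T. \<xi> t \<noteq> 0) \<and>
     (\<forall>s\<in>T. \<forall>t\<in>T. \<xi> (s ** t) = \<xi> s * \<xi> t)}"

definition root_space ::
  "(complex^'N^'N) set \<Rightarrow> (complex^'N^'N) set \<Rightarrow> (complex^'N^'N \<Rightarrow> complex) \<Rightarrow> (complex^'N^'N) set" where
  "root_space G T \<xi> = {X \<in> lie_algebra G. \<forall>t\<in>T. t ** X ** matrix_inv t = cscale (\<xi> t) X}"

definition roots ::
  "(complex^'N^'N) set \<Rightarrow> (complex^'N^'N) set \<Rightarrow> (complex^'N^'N \<Rightarrow> complex) set" where
  "roots G T = {\<xi> \<in> characters T. (\<exists>t\<in>T. \<xi> t \<noteq> 1) \<and> root_space G T \<xi> \<noteq> {0}}"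

definition is_combination ::
  "(complex^'N^'N) set \<Rightarrow> ('n::finite \<Rightarrow> complex^'N^'N \<Rightarrow> complex) \<Rightarrow>
   (complex^'N^'N \<Rightarrow> complex) \<Rightarrow> ('n \<Rightarrow> int) \<Rightarrow> bool" where
  "is_combination T \<alpha> \<xi> k \<longleftrightarrow> (\<forall>X\<in>lie_algebra T.
     differential T \<xi> X = (\<Sum>i\<in>UNIV. of_int (k i) * differential T (\<alpha> i) X))"

definition simple_roots ::
  "(complex^'N^'N) set \<Rightarrow> (complex^'N^'N) set \<Rightarrow>
   ('n::finite \<Rightarrow> complex^'N^'N \<Rightarrow> complex) \<Rightarrow> bool" where
  "simple_roots G T \<alpha> \<longleftrightarrow> (\<forall>i. \<alpha> i \<in> roots G T) \<and>
     (\<forall>a. (\<forall>X\<in>lie_algebra T. (\<Sum>i\<in>UNIV. a i * differential T (\<alpha> i) X) = 0) \<longrightarrow> (\<forall>i. a i = 0)) \<and>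
     (\<forall>\<beta>\<in>roots G T. \<exists>k. is_combination T \<alpha> \<beta> k \<and> ((\<forall>i. k i \<ge> 0) \<or> (\<forall>i. k i \<le> 0)))"

definition positive_roots ::
  "(complex^'N^'N) set \<Rightarrow> (complex^'N^'N) set \<Rightarrow>
   ('n::finite \<Rightarrow> complex^'N^'N \<Rightarrow> complex) \<Rightarrow> (complex^'N^'N \<Rightarrow> complex) set" where
  "positive_roots G T \<alpha> = {\<beta> \<in> roots G T. \<exists>k. is_combination T \<alpha> \<beta> k \<and> (\<forall>i. k i \<ge> 0)}"

text \<open>
  The coroot of \<open>\<beta>\<close> is the element \<open>h\<close> of the line \<open>[\<gg>\<^sub>\<beta>, \<gg>\<^sub>-\<^sub>\<beta>]\<close> with \<open>\<beta>(h) = 2\<close>. Root spaces are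
  one-dimensional, so every element of that line is a single bracket.
\<close>

definition is_coroot ::
  "(complex^'N^'N) set \<Rightarrow> (complex^'N^'N) set \<Rightarrow>
   (complex^'N^'N \<Rightarrow> complex) \<Rightarrow> complex^'N^'N \<Rightarrow> bool" where
  "is_coroot G T \<beta> h \<longleftrightarrow> h \<in> lie_algebra T \<and> differential T \<beta> h = 2 \<and>
     (\<exists>e\<in>root_space G T \<beta>. \<exists>f\<in>root_space G T (\<lambda>t. inverse (\<beta> t)). h = bracket e f)"

subsection \<open>Representations and weights\<close>

definition irreducible_rep ::
  "(complex^'N^'N) set \<Rightarrow> (complex^'N^'N \<Rightarrow> complex^'v^'v) \<Rightarrow> bool" where
  "irreducible_rep G \<rho> \<longleftrightarrow> alg_hom G GL \<rho> \<and>
     (\<forall>W. vec.subspace W \<and> (\<forall>g\<in>G. \<forall>w\<in>W. \<rho> g *v w \<in> W) \<longrightarrow> W = {0} \<or> W = UNIV)"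

definition weight_space ::
  "(complex^'N^'N) set \<Rightarrow> (complex^'N^'N \<Rightarrow> complex^'v^'v) \<Rightarrow>
   (complex^'N^'N \<Rightarrow> complex) \<Rightarrow> (complex^'v) set" where
  "weight_space T \<rho> \<mu> = {v. \<forall>t\<in>T. \<rho> t *v v = \<mu> t *s v}"

definition weights ::
  "(complex^'N^'N) set \<Rightarrow> (complex^'N^'N \<Rightarrow> complex^'v^'v) \<Rightarrow> (complex^'N^'N \<Rightarrow> complex) set" where
  "weights T \<rho> = {\<mu> \<in> characters T. weight_space T \<rho> \<mu> \<noteq> {0}}"

definition weight_mset ::
  "(complex^'N^'N) set \<Rightarrow> (complex^'N^'N \<Rightarrow> complex^'v^'v) \<Rightarrow>
   (complex^'N^'N \<Rightarrow> complex) multiset" where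
  "weight_mset T \<rho> = (\<Sum>\<mu>\<in>weights T \<rho>. replicate_mset (vec.dim (weight_space T \<rho> \<mu>)) \<mu>)"

definition highest_weight ::
  "(complex^'N^'N) set \<Rightarrow> (complex^'N^'N) set \<Rightarrow> ('n::finite \<Rightarrow> complex^'N^'N \<Rightarrow> complex) \<Rightarrow>
   (complex^'N^'N \<Rightarrow> complex^'v^'v) \<Rightarrow> (complex^'N^'N \<Rightarrow> complex) \<Rightarrow> bool" where
  "highest_weight G T \<alpha> \<rho> \<mu> \<longleftrightarrow> \<mu> \<in> weights T \<rho> \<and>
     (\<exists>v\<in>weight_space T \<rho> \<mu>. v \<noteq> 0 \<and>
        (\<forall>\<beta>\<in>positive_roots G T \<alpha>. \<forall>X\<in>root_space G T \<beta>. rep_differential G \<rho> X *v v = 0))"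

text \<open>
  The coordinate \<open>\<mu>\<^sub>i\<close> of \<open>\<mu> = \<Sum>\<^sub>i \<mu>\<^sub>i \<omega>\<^sub>i\<close>. As the fundamental weights are the basis dual to the
  simple coroots \<open>h i\<close>, it is the value of (the differential of) \<open>\<mu>\<close> at \<open>h i\<close>.
\<close>

definition weight_coord ::
  "(complex^'N^'N) set \<Rightarrow> ('n \<Rightarrow> complex^'N^'N) \<Rightarrow>
   (complex^'N^'N \<Rightarrow> complex) \<Rightarrow> 'n \<Rightarrow> complex" where
  "weight_coord T h \<mu> i = differential T \<mu> (h i)"

subsection \<open>The Springer morphism\<close>

definition trace_perp :: "(complex^'v^'v) set \<Rightarrow> (complex^'v^'v) set" where
  "trace_perp U = {A. \<forall>B\<in>U. trace (A ** B) = 0}"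

text \<open>The whole matrix space is \<open>U \<oplus> W\<close> and \<open>\<pi>\<close> is the projection onto \<open>U\<close>.\<close>

definition is_projection ::
  "(complex^'v^'v) set \<Rightarrow> (complex^'v^'v) set \<Rightarrow> (complex^'v^'v \<Rightarrow> complex^'v^'v) \<Rightarrow> bool" where
  "is_projection U W \<pi> \<longleftrightarrow> U \<inter> W = {0} \<and> (\<forall>A. \<pi> A \<in> U \<and> A - \<pi> A \<in> W)"

text \<open>
  \<open>\<pi>\<close> takes values in the image of \<open>rep_differential G \<rho>\<close>, which is identified with the Lie
  algebra of \<open>G\<close>.
\<close>

definition springer_morphism ::
  "(complex^'N^'N) set \<Rightarrow> (complex^'N^'N \<Rightarrow> complex^'v^'v) \<Rightarrow>
   (complex^'v^'v \<Rightarrow> complex^'v^'v) \<Rightarrow> complex^'N^'N \<Rightarrow> complex^'N^'N" where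
  "springer_morphism G \<rho> \<pi> g = inv_into (lie_algebra G) (rep_differential G \<rho>) (\<pi> (\<rho> g))"

definition S_matrix ::
  "(complex^'N^'N) set \<Rightarrow> ('n \<Rightarrow> complex^'N^'N) \<Rightarrow>
   (complex^'N^'N \<Rightarrow> complex^'v^'v) \<Rightarrow> complex^'n^'n" where
  "S_matrix T h \<rho> =
     (\<chi> i j. \<Sum>\<mu>\<in>#weight_mset T \<rho>. weight_coord T h \<mu> i * weight_coord T h \<mu> j)"

end

theory Submission
  imports Defs
begin

text \<open>
  Pairing \<open>\<rho>(t) - \<pi>(\<rho>(t)) \<in> \<gg>\<^sup>\<bottom>\<close> with \<open>d\<rho>(h\<^sub>i)\<close> gives \<open>tr(\<rho>(t) d\<rho>(h\<^sub>i)) = \<Sum>\<^sub>j c\<^sub>j tr(d\<rho>(h\<^sub>j) d\<rho>(h\<^sub>i))\<close>,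
  and both traces are computed on the weight space decomposition of \<open>V\<close>.

  Invertibility of \<open>S\<close> does not use the root space decomposition of \<open>\<gg>\<close>. All \<open>\<mu>\<^sub>i\<close> are real, so
  \<open>S x = 0\<close> forces \<open>\<Sum>\<^sub>\<mu> |\<Sum>\<^sub>i \<mu>\<^sub>i x\<^sub>i|\<^sup>2 = 0\<close>, that is \<open>d\<rho>(\<Sum>\<^sub>i x\<^sub>i h\<^sub>i) = 0\<close>; exponentiating inside the torus,
  finiteness of the kernel gives \<open>\<Sum>\<^sub>i x\<^sub>i h\<^sub>i = 0\<close>. Finally the coroots are independent, because
  \<open>tr(h\<^sub>i Y) = tr(e\<^sub>i f\<^sub>i) \<alpha>\<^sub>i(Y)\<close> in \<open>\<complex>^N\<close> with \<open>2 tr(e\<^sub>i f\<^sub>i) = tr(h\<^sub>i\<^sup>2) > 0\<close>.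

  Reality of the \<open>\<mu>\<^sub>i\<close> is also seen in \<open>\<complex>^N\<close>: \<open>sl\<^sub>2\<close>-theory makes the eigenvalues of \<open>h\<^sub>i\<close> on \<open>\<complex>^N\<close>
  integers, so the imaginary part of \<open>h\<^sub>i\<close> exponentiates to the identity matrix, on which
  every character of \<open>T\<close> is 1.
\<close>

subsection \<open>Differentials of regular functions\<close>

lemma cscale_0 [simp]: "cscale 0 X = 0"
  by (simp add: cscale_def vec_eq_iff)

section \<open>Polynomial and regular functions\<close>

lemma polyfun_sum: "(\<And>i. i \<in> S \<Longrightarrow> polyfun (f i)) \<Longrightarrow> polyfun (\<lambda>A. \<Sum>i\<in>S. f i A)"
  by (induction S rule: infinite_finite_induct) (auto intro: polyfun.intros)

lemma polyfun_prod: "(\<And>i. i \<in> S \<Longrightarrow> polyfun (f i)) \<Longrightarrow> polyfun (\<lambda>A. \<Prod>i\<in>S. f i A)"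
  by (induction S rule: infinite_finite_induct) (auto intro: polyfun.intros)

lemma polyfun_power: "polyfun p \<Longrightarrow> polyfun (\<lambda>A. p A ^ k)"
  by (induction k) (auto intro: polyfun.intros)

lemma polyfun_det: "polyfun det"
  unfolding det_def[abs_def] by (intro polyfun_sum polyfun_prod polyfun.intros)

lemma regular_GL_polyfun: "polyfun p \<Longrightarrow> regular_GL p"
  unfolding regular_GL_def by (rule exI[of _ p], rule exI[of _ 0]) auto

lemma regular_GL_add:
  assumes "regular_GL F" "regular_GL F'"
  shows "regular_GL (\<lambda>A. F A + F' A)"
proof -
  obtain p k p' k' where p: "polyfun p" "\<forall>g\<in>GL. F g = p g / det g ^ k"
      "polyfun p'" "\<forall>g\<in>GL. F' g = p' g / det g ^ k'"
    using assms unfolding regular_GL_def by blast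
  have "polyfun (\<lambda>A. p A * det A ^ k' + p' A * det A ^ k)"
    by (intro polyfun.add polyfun.mult polyfun_power polyfun_det p)
  moreover have "\<forall>g\<in>GL. F g + F' g = (p g * det g ^ k' + p' g * det g ^ k) / det g ^ (k + k')"
    using p(2,4) by (auto simp: invertible_det_nz field_simps power_add)
  ultimately show ?thesis unfolding regular_GL_def by (intro exI conjI)
qed

lemma regular_GL_mult:
  assumes "regular_GL F" "regular_GL F'"
  shows "regular_GL (\<lambda>A. F A * F' A)"
proof -
  obtain p k p' k' where p: "polyfun p" "\<forall>g\<in>GL. F g = p g / det g ^ k"
      "polyfun p'" "\<forall>g\<in>GL. F' g = p' g / det g ^ k'"
    using assms unfolding regular_GL_def by blast
  have "polyfun (\<lambda>A. p A * p' A)"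
    by (intro polyfun.mult p)
  moreover have "\<forall>g\<in>GL. F g * F' g = (p g * p' g) / det g ^ (k + k')"
    using p(2,4) by (auto simp: power_add)
  ultimately show ?thesis unfolding regular_GL_def by (intro exI conjI)
qed

text \<open>The coefficients \<open>g\<close> are chosen before the direction \<open>X\<close>. Thus
  the derivative at the identity is a linear form in \<open>X\<close>, from which linearity of
  tangent spaces and of differentials follows.\<close>

lemma polyfun_deriv:
  fixes p :: "complex^'N^'N \<Rightarrow> complex"
  assumes "polyfun p"
  shows "\<exists>g. \<forall>X. ((\<lambda>s. p (mat 1 + cscale s X)) has_field_derivative
           (\<Sum>i\<in>UNIV. \<Sum>j\<in>UNIV. g i j * X$i$j)) (at 0)"
  using assms
proof induction
  case (const a)
  show ?case by (rule exI[of _ "\<lambda>_ _. 0"]) simp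
next
  case (entry k l)
  have "((\<lambda>s. (mat 1 + cscale s X)$k$l) has_field_derivative
          (\<Sum>i\<in>UNIV. \<Sum>j\<in>UNIV. (if i = k then if j = l then 1 else 0 else 0) * X$i$j)) (at 0)" for X
  proof -
    have row: "(\<Sum>j\<in>UNIV. (if i = k then if j = l then 1 else 0 else 0) * X$i$j)
        = (if i = k then X$i$l else 0)" for i
    proof -
      have "(\<Sum>j\<in>UNIV. (if i = k then if j = l then 1 else 0 else 0) * X$i$j)
          = (\<Sum>j\<in>UNIV. if j = l then if i = k then X$i$j else 0 else 0)"
        by (rule sum.cong) auto
      then show ?thesis by simp
    qed
    have "(\<Sum>i\<in>UNIV. \<Sum>j\<in>UNIV. (if i = k then if j = l then 1 else 0 else 0) * X$i$j)
        = (\<Sum>i\<in>UNIV. if i = k then X$i$l else 0)"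
      by (simp only: row)
    also have "\<dots> = X$k$l" by simp
    finally show ?thesis
      by (auto simp: cscale_def intro!: derivative_eq_intros)
  qed
  then show ?case
    by (intro exI[of _ "\<lambda>i j. if i = k then if j = l then 1 else 0 else 0"] allI)
next
  case (add p q)
  then obtain g g' where g:
    "\<And>X. ((\<lambda>s. p (mat 1 + cscale s X)) has_field_derivative (\<Sum>i\<in>UNIV. \<Sum>j\<in>UNIV. g i j * X$i$j)) (at 0)"
    "\<And>X. ((\<lambda>s. q (mat 1 + cscale s X)) has_field_derivative (\<Sum>i\<in>UNIV. \<Sum>j\<in>UNIV. g' i j * X$i$j)) (at 0)"
    by blast
  show ?case
    by (rule exI[of _ "\<lambda>i j. g i j + g' i j"])
       (use DERIV_add[OF g] in \<open>simp add: distrib_right sum.distrib\<close>)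
next
  case (mult p q)
  then obtain g g' where g:
    "\<And>X. ((\<lambda>s. p (mat 1 + cscale s X)) has_field_derivative (\<Sum>i\<in>UNIV. \<Sum>j\<in>UNIV. g i j * X$i$j)) (at 0)"
    "\<And>X. ((\<lambda>s. q (mat 1 + cscale s X)) has_field_derivative (\<Sum>i\<in>UNIV. \<Sum>j\<in>UNIV. g' i j * X$i$j)) (at 0)"
    by blast
  show ?case
  proof (intro exI[of _ "\<lambda>i j. g i j * q (mat 1) + g' i j * p (mat 1)"] allI)
    fix X :: "complex^'N^'N"
    show "((\<lambda>s. p (mat 1 + cscale s X) * q (mat 1 + cscale s X)) has_field_derivative
       (\<Sum>i\<in>UNIV. \<Sum>j\<in>UNIV. (g i j * q (mat 1) + g' i j * p (mat 1)) * X$i$j)) (at 0)"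
      using DERIV_mult[OF g, of X X]
      by (simp add: algebra_simps sum.distrib sum_distrib_left)
  qed
qed

lemma eventually_det_nz: "\<forall>\<^sub>F s in nhds 0. det (mat 1 + cscale s X) \<noteq> 0"
proof -
  obtain d where "((\<lambda>s. det (mat 1 + cscale s X)) has_field_derivative d) (at 0)"
    using polyfun_deriv[OF polyfun_det] by blast
  then have "isCont (\<lambda>s. det (mat 1 + cscale s X)) 0" by (rule DERIV_isCont)
  then have "((\<lambda>s. det (mat 1 + cscale s X)) \<longlongrightarrow> det (mat 1 + cscale 0 X)) (nhds 0)"
    unfolding isCont_def by (subst (asm) tendsto_at_iff_tendsto_nhds)
  then show ?thesis by (rule tendsto_imp_eventually_ne) simp
qed

lemma regular_GL_deriv:
  fixes F :: "complex^'N^'N \<Rightarrow> complex"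
  assumes "regular_GL F"
  shows "\<exists>g. \<forall>X. ((\<lambda>s. F (mat 1 + cscale s X)) has_field_derivative
           (\<Sum>i\<in>UNIV. \<Sum>j\<in>UNIV. g i j * X$i$j)) (at 0)"
proof -
  obtain p k where p: "polyfun p" "\<And>g. invertible g \<Longrightarrow> F g = p g / det g ^ k"
    using assms unfolding regular_GL_def by blast
  obtain g where g: "\<And>X. ((\<lambda>s. p (mat 1 + cscale s X)) has_field_derivative
       (\<Sum>i\<in>UNIV. \<Sum>j\<in>UNIV. g i j * X$i$j)) (at 0)"
    using polyfun_deriv[OF p(1)] by blast
  obtain d where d: "\<And>X :: complex^'N^'N. ((\<lambda>s. det (mat 1 + cscale s X) ^ k) has_field_derivative
       (\<Sum>i\<in>UNIV. \<Sum>j\<in>UNIV. d i j * X$i$j)) (at 0)"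
    using polyfun_deriv[OF polyfun_power[OF polyfun_det]] by blast
  have "((\<lambda>s. F (mat 1 + cscale s X)) has_field_derivative
           (\<Sum>i\<in>UNIV. \<Sum>j\<in>UNIV. (g i j - p (mat 1) * d i j) * X$i$j)) (at 0)" for X :: "complex^'N^'N"
  proof -
    note ev = eventually_det_nz[of X]
    \<comment> \<open>The determinant is 1 at \<open>s = 0\<close>, so no denominator survives in
      the quotient rule.\<close>
    have "((\<lambda>s. p (mat 1 + cscale s X) / det (mat 1 + cscale s X) ^ k) has_field_derivative
           (\<Sum>i\<in>UNIV. \<Sum>j\<in>UNIV. (g i j - p (mat 1) * d i j) * X$i$j)) (at 0)"
      using DERIV_divide[OF g d, of X X]
      by (simp add: algebra_simps sum_subtractf sum_distrib_left)
    then show ?thesis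
      by (rule DERIV_cong_ev[OF refl _ refl, THEN iffD2, rotated])
         (use ev in \<open>eventually_elim, simp add: p(2) invertible_det_nz\<close>)
  qed
  then show ?thesis
    by (intro exI[of _ "\<lambda>i j. g i j - p (mat 1) * d i j"] allI)
qed

lemma algebraic_group_GL: "algebraic_group G \<Longrightarrow> G \<subseteq> GL"
  unfolding algebraic_group_def zariski_closed_def by blast

text \<open>Shows that the definite description in \<open>differential\<close> is meaningful. Two
  regular extensions differ by p / det^k with \<open>p\<close> vanishing on \<open>G\<close>; a
  tangent vector annihilates \<open>p\<close>, and \<open>p\<close> is 0 at the identity, so the
  quotient rule gives derivative 0 for the difference.\<close>

lemma differential_eq:
  assumes G: "algebraic_group G" and X: "X \<in> lie_algebra G"
    and F: "regular_GL F" "\<And>g. g \<in> G \<Longrightarrow> f g = F g"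
  shows "differential G f X = deriv (\<lambda>s. F (mat 1 + cscale s X)) 0"
proof -
  have "deriv (\<lambda>s. F' (mat 1 + cscale s X)) 0 = deriv (\<lambda>s. F (mat 1 + cscale s X)) 0"
    if F': "regular_GL F'" "\<forall>g\<in>G. f g = F' g" for F'
  proof -
    have "regular_GL (\<lambda>A. F' A + (-1) * F A)"
      by (intro regular_GL_add regular_GL_mult F F' regular_GL_polyfun polyfun.const)
    then obtain p k where p: "polyfun p" "\<And>g. invertible g \<Longrightarrow> F' g - F g = p g / det g ^ k"
      unfolding regular_GL_def by auto
    have p0: "\<forall>g\<in>G. p g = 0"
      using p(2) F(2) F'(2) algebraic_group_GL[OF G] by (force simp: invertible_det_nz)
    have 1: "mat 1 \<in> G" using G by (simp add: algebraic_group_def)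
    have dp: "deriv (\<lambda>s. p (mat 1 + cscale s X)) 0 = 0"
      using X p(1) p0 unfolding lie_algebra_def by blast
    obtain g where g: "((\<lambda>s. p (mat 1 + cscale s X)) has_field_derivative g) (at 0)"
      using polyfun_deriv[OF p(1)] by blast
    have g': "((\<lambda>s. p (mat 1 + cscale s X)) has_field_derivative 0) (at 0)"
      using g dp DERIV_imp_deriv by metis
    obtain d where d: "((\<lambda>s. det (mat 1 + cscale s X) ^ k) has_field_derivative d) (at 0)"
      using polyfun_deriv[OF polyfun_power[OF polyfun_det]] by blast
    obtain a where a: "((\<lambda>s. F (mat 1 + cscale s X)) has_field_derivative a) (at 0)"
      using regular_GL_deriv[OF F(1)] by blast
    obtain b where b: "((\<lambda>s. F' (mat 1 + cscale s X)) has_field_derivative b) (at 0)"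
      using regular_GL_deriv[OF F'(1)] by blast
    note ev = eventually_det_nz[of X]
    have "((\<lambda>s. p (mat 1 + cscale s X) / det (mat 1 + cscale s X) ^ k) has_field_derivative 0) (at 0)"
      using DERIV_divide[OF g' d] p0 1 by simp
    then have "((\<lambda>s. F' (mat 1 + cscale s X) - F (mat 1 + cscale s X)) has_field_derivative 0) (at 0)"
      by (rule DERIV_cong_ev[OF refl _ refl, THEN iffD2, rotated])
         (use ev in \<open>eventually_elim, simp add: p(2) invertible_det_nz\<close>)
    then have "b - a = 0" using DERIV_diff[OF b a] DERIV_unique by blast
    then show ?thesis using DERIV_imp_deriv[OF a] DERIV_imp_deriv[OF b] by simp
  qed
  then show ?thesis
    unfolding differential_def using F by (intro the_equality) (blast, metis)
qed

section \<open>Linearity of the differential and restriction to subgroups\<close>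

lemma differential_linear:
  assumes "algebraic_group G" "regular_on G f"
  shows "\<exists>g. \<forall>X\<in>lie_algebra G. differential G f X = (\<Sum>i\<in>UNIV. \<Sum>j\<in>UNIV. g i j * X$i$j)"
proof -
  obtain F where F: "regular_GL F" "\<And>g. g \<in> G \<Longrightarrow> f g = F g"
    using assms(2) unfolding regular_on_def by blast
  obtain g where g: "\<And>X. ((\<lambda>s. F (mat 1 + cscale s X)) has_field_derivative
           (\<Sum>i\<in>UNIV. \<Sum>j\<in>UNIV. g i j * X$i$j)) (at 0)"
    using regular_GL_deriv[OF F(1)] by blast
  show ?thesis
    by (rule exI[of _ g], rule ballI, subst differential_eq[OF assms(1) _ F])
       (auto intro: DERIV_imp_deriv g)
qed

text \<open>By \<open>polyfun_deriv\<close> each tangency condition is a homogeneous linear equation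
  in the entries of the matrix.\<close>

lemma lie_algebra_sum:
  fixes G :: "(complex^'N^'N) set"
  assumes "\<And>i. i \<in> S \<Longrightarrow> X i \<in> lie_algebra G"
  shows "(\<Sum>i\<in>S. cscale (c i) (X i)) \<in> lie_algebra G"
  unfolding lie_algebra_def
proof (intro CollectI allI impI, elim conjE)
  fix p :: "complex^'N^'N \<Rightarrow> complex"
  assume p: "polyfun p" "\<forall>g\<in>G. p g = 0"
  obtain g where g: "\<And>X. ((\<lambda>s. p (mat 1 + cscale s X)) has_field_derivative
       (\<Sum>i\<in>UNIV. \<Sum>j\<in>UNIV. g i j * X$i$j)) (at 0)"
    using polyfun_deriv[OF p(1)] by blast
  have z: "(\<Sum>i\<in>UNIV. \<Sum>j\<in>UNIV. g i j * X l$i$j) = 0" if "l \<in> S" for l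
    using assms[OF that] p DERIV_imp_deriv[OF g, of "X l"] unfolding lie_algebra_def by auto
  have "(\<Sum>i\<in>UNIV. \<Sum>j\<in>UNIV. g i j * (\<Sum>l\<in>S. cscale (c l) (X l))$i$j)
      = (\<Sum>i\<in>UNIV. \<Sum>j\<in>UNIV. \<Sum>l\<in>S. c l * (g i j * X l$i$j))"
    by (simp add: cscale_def sum_distrib_left mult_ac)
  also have "\<dots> = (\<Sum>i\<in>UNIV. \<Sum>l\<in>S. \<Sum>j\<in>UNIV. c l * (g i j * X l$i$j))"
    by (intro sum.cong refl sum.swap)
  also have "\<dots> = (\<Sum>l\<in>S. \<Sum>i\<in>UNIV. \<Sum>j\<in>UNIV. c l * (g i j * X l$i$j))"
    by (rule sum.swap)
  also have "\<dots> = (\<Sum>l\<in>S. c l * (\<Sum>i\<in>UNIV. \<Sum>j\<in>UNIV. g i j * X l$i$j))"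
    by (simp add: sum_distrib_left)
  also have "\<dots> = 0" using z by simp
  finally show "deriv (\<lambda>s. p (mat 1 + cscale s (\<Sum>l\<in>S. cscale (c l) (X l)))) 0 = 0"
    using DERIV_imp_deriv[OF g] by metis
qed

lemma differential_sum_right:
  assumes "algebraic_group G" "regular_on G f" "\<And>i. i \<in> S \<Longrightarrow> X i \<in> lie_algebra G"
  shows "differential G f (\<Sum>i\<in>S. cscale (c i) (X i)) = (\<Sum>i\<in>S. c i * differential G f (X i))"
proof -
  obtain g where g: "\<And>X. X \<in> lie_algebra G \<Longrightarrow>
      differential G f X = (\<Sum>i\<in>UNIV. \<Sum>j\<in>UNIV. g i j * X$i$j)"
    using differential_linear[OF assms(1,2)] by blast
  have "differential G f (\<Sum>i\<in>S. cscale (c i) (X i)) =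
     (\<Sum>i\<in>UNIV. \<Sum>j\<in>UNIV. g i j * (\<Sum>l\<in>S. cscale (c l) (X l))$i$j)"
    by (intro g lie_algebra_sum assms)
  also have "\<dots> = (\<Sum>i\<in>UNIV. \<Sum>j\<in>UNIV. \<Sum>l\<in>S. c l * (g i j * X l$i$j))"
    by (simp add: cscale_def sum_distrib_left mult_ac)
  also have "\<dots> = (\<Sum>i\<in>UNIV. \<Sum>l\<in>S. \<Sum>j\<in>UNIV. c l * (g i j * X l$i$j))"
    by (intro sum.cong refl sum.swap)
  also have "\<dots> = (\<Sum>l\<in>S. \<Sum>i\<in>UNIV. \<Sum>j\<in>UNIV. c l * (g i j * X l$i$j))"
    by (rule sum.swap)
  also have "\<dots> = (\<Sum>l\<in>S. c l * differential G f (X l))"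
    by (simp add: sum_distrib_left g assms)
  finally show ?thesis .
qed

lemma differential_cong: "(\<And>g. g \<in> G \<Longrightarrow> f g = f' g) \<Longrightarrow> differential G f X = differential G f' X"
  unfolding differential_def by (metis (no_types, lifting))

lemma regular_on_cong: "(\<And>g. g \<in> G \<Longrightarrow> f g = f' g) \<Longrightarrow> regular_on G f = regular_on G f'"
  unfolding regular_on_def by auto

lemma regular_on_subset: "regular_on G f \<Longrightarrow> T \<subseteq> G \<Longrightarrow> regular_on T f"
  unfolding regular_on_def by blast

lemma lie_algebra_mono: "T \<subseteq> G \<Longrightarrow> lie_algebra T \<subseteq> lie_algebra G"
  unfolding lie_algebra_def by blast

text \<open>A regular extension of a function on \<open>G\<close> also extends its restriction to
  \<open>T\<close>, so one \<open>F\<close> computes both sides. This is how the representation of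
  \<open>G\<close> is differentiated along its torus.\<close>

lemma differential_subset:
  assumes "algebraic_group G" "algebraic_group T" "T \<subseteq> G" "regular_on G f" "X \<in> lie_algebra T"
  shows "differential G f X = differential T f X"
proof -
  obtain F where F: "regular_GL F" "\<And>g. g \<in> G \<Longrightarrow> f g = F g"
    using assms(4) unfolding regular_on_def by blast
  have "X \<in> lie_algebra G" using assms(3,5) lie_algebra_mono by blast
  then have "differential G f X = deriv (\<lambda>s. F (mat 1 + cscale s X)) 0"
    by (intro differential_eq[OF assms(1) _ F])
  also have "\<dots> = differential T f X"
    by (rule differential_eq[OF assms(2,5) F(1), symmetric]) (use F(2) assms(3) in blast)
  finally show ?thesis .
qed

section \<open>Differentiation rules for regular functions on a group\<close>

lemma regular_on_polyfun: "polyfun p \<Longrightarrow> regular_on G p"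
  unfolding regular_on_def using regular_GL_polyfun by blast

lemma regular_on_const: "regular_on G (\<lambda>_. c)"
  by (intro regular_on_polyfun polyfun.intros)

lemma regular_on_entry: "regular_on G (\<lambda>A. A$i$j)"
  by (intro regular_on_polyfun polyfun.intros)

lemma regular_on_add: "regular_on G f \<Longrightarrow> regular_on G f' \<Longrightarrow> regular_on G (\<lambda>A. f A + f' A)"
  unfolding regular_on_def using regular_GL_add by fastforce

lemma regular_on_mult: "regular_on G f \<Longrightarrow> regular_on G f' \<Longrightarrow> regular_on G (\<lambda>A. f A * f' A)"
  unfolding regular_on_def using regular_GL_mult by fastforce

lemma regular_on_sum: "(\<And>i. i \<in> S \<Longrightarrow> regular_on G (f i)) \<Longrightarrow> regular_on G (\<lambda>A. \<Sum>i\<in>S. f i A)"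
  by (induction S rule: infinite_finite_induct) (auto intro: regular_on_const regular_on_add)

lemma regular_on_prod: "(\<And>i. i \<in> S \<Longrightarrow> regular_on G (f i)) \<Longrightarrow> regular_on G (\<lambda>A. \<Prod>i\<in>S. f i A)"
  by (induction S rule: infinite_finite_induct) (auto intro: regular_on_const regular_on_mult)

lemma regular_on_power: "regular_on G f \<Longrightarrow> regular_on G (\<lambda>A. f A ^ k)"
  by (induction k) (auto intro: regular_on_const regular_on_mult)

lemma differential_const:
  "algebraic_group G \<Longrightarrow> X \<in> lie_algebra G \<Longrightarrow> differential G (\<lambda>_. c) X = 0"
  by (subst differential_eq[where F = "\<lambda>_. c"]) (auto intro: regular_GL_polyfun polyfun.intros)

lemma differential_entry:
  assumes "algebraic_group G" "X \<in> lie_algebra G"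
  shows "differential G (\<lambda>A. A$i$j) X = X$i$j"
proof -
  have "((\<lambda>s. (mat 1 + cscale s X)$i$j) has_field_derivative X$i$j) (at 0)"
    by (auto simp: cscale_def intro!: derivative_eq_intros)
  then show ?thesis
    by (subst differential_eq[where F = "\<lambda>A. A$i$j"])
       (use assms in \<open>auto intro: DERIV_imp_deriv regular_GL_polyfun polyfun.intros\<close>)
qed

lemma differential_add:
  assumes G: "algebraic_group G" "X \<in> lie_algebra G" and "regular_on G f" "regular_on G f'"
  shows "differential G (\<lambda>A. f A + f' A) X = differential G f X + differential G f' X"
proof -
  obtain F F' where F: "regular_GL F" "\<And>g. g \<in> G \<Longrightarrow> f g = F g"
      "regular_GL F'" "\<And>g. g \<in> G \<Longrightarrow> f' g = F' g"
    using assms(3,4) unfolding regular_on_def by metis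
  obtain a where a: "((\<lambda>s. F (mat 1 + cscale s X)) has_field_derivative a) (at 0)"
    using regular_GL_deriv[OF F(1)] by blast
  obtain b where b: "((\<lambda>s. F' (mat 1 + cscale s X)) has_field_derivative b) (at 0)"
    using regular_GL_deriv[OF F(3)] by blast
  have "differential G f X = a" "differential G f' X = b"
    using differential_eq[OF G F(1,2)] differential_eq[OF G F(3,4)] a b
    by (auto dest: DERIV_imp_deriv)
  moreover have "differential G (\<lambda>A. f A + f' A) X = a + b"
    using differential_eq[OF G regular_GL_add[OF F(1,3)]] F(2,4) DERIV_imp_deriv[OF DERIV_add[OF a b]]
    by simp
  ultimately show ?thesis by simp
qed

lemma differential_mult:
  assumes G: "algebraic_group G" "X \<in> lie_algebra G" and "regular_on G f" "regular_on G f'"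
  shows "differential G (\<lambda>A. f A * f' A) X =
     differential G f X * f' (mat 1) + f (mat 1) * differential G f' X"
proof -
  obtain F F' where F: "regular_GL F" "\<And>g. g \<in> G \<Longrightarrow> f g = F g"
      "regular_GL F'" "\<And>g. g \<in> G \<Longrightarrow> f' g = F' g"
    using assms(3,4) unfolding regular_on_def by metis
  obtain a where a: "((\<lambda>s. F (mat 1 + cscale s X)) has_field_derivative a) (at 0)"
    using regular_GL_deriv[OF F(1)] by blast
  obtain b where b: "((\<lambda>s. F' (mat 1 + cscale s X)) has_field_derivative b) (at 0)"
    using regular_GL_deriv[OF F(3)] by blast
  have "differential G f X = a" "differential G f' X = b"
    using differential_eq[OF G F(1,2)] differential_eq[OF G F(3,4)] a b
    by (auto dest: DERIV_imp_deriv)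
  moreover have "differential G (\<lambda>A. f A * f' A) X = a * F' (mat 1) + F (mat 1) * b"
    using differential_eq[OF G regular_GL_mult[OF F(1,3)]] F(2,4) DERIV_imp_deriv[OF DERIV_mult[OF a b]]
    by (simp add: mult.commute)
  ultimately show ?thesis using F G(1) by (simp add: algebraic_group_def)
qed

lemma differential_cmult:
  assumes "algebraic_group G" "X \<in> lie_algebra G" "regular_on G f"
  shows "differential G (\<lambda>A. c * f A) X = c * differential G f X"
  using differential_mult[OF assms(1,2) regular_on_const assms(3)] differential_const[OF assms(1,2)]
  by simp

lemma differential_sum:
  assumes G: "algebraic_group G" "X \<in> lie_algebra G"
  shows "(\<And>i. i \<in> S \<Longrightarrow> regular_on G (f i)) \<Longrightarrow>
    differential G (\<lambda>A. \<Sum>i\<in>S. f i A) X = (\<Sum>i\<in>S. differential G (f i) X)"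
  by (induction S rule: infinite_finite_induct)
     (auto simp: differential_const[OF G] differential_add[OF G] regular_on_sum)

text \<open>With every factor equal to 1 at the identity, the cofactors in the Leibniz rule
  disappear.\<close>

lemma differential_prod:
  assumes G: "algebraic_group G" "X \<in> lie_algebra G"
  shows "(\<And>i. i \<in> S \<Longrightarrow> regular_on G (f i)) \<Longrightarrow> (\<And>i. i \<in> S \<Longrightarrow> f i (mat 1) = 1) \<Longrightarrow>
    differential G (\<lambda>A. \<Prod>i\<in>S. f i A) X = (\<Sum>i\<in>S. differential G (f i) X)"
  by (induction S rule: infinite_finite_induct)
     (auto simp: differential_const[OF G] differential_mult[OF G] regular_on_prod)

lemma differential_power:
  assumes G: "algebraic_group G" "X \<in> lie_algebra G" and f: "regular_on G f" "f (mat 1) = 1"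
  shows "differential G (\<lambda>A. f A ^ k) X = of_nat k * differential G f X"
  by (induction k)
     (auto simp: differential_const[OF G] differential_mult[OF G] regular_on_power f algebra_simps)

subsection \<open>Scalar multiples and sums of matrices\<close>

lemma cscale_nth [simp]: "cscale s X $ i $ j = s * X $ i $ j"
  by (simp add: cscale_def)

lemma cscale_1 [simp]: "cscale 1 X = X"
  by (simp add: vec_eq_iff)

lemma cscale_zero_right [simp]: "cscale s 0 = 0"
  by (simp add: vec_eq_iff)

lemma cscale_cscale [simp]: "cscale s (cscale t X) = cscale (s * t) X"
  by (simp add: vec_eq_iff)

lemma cscale_mult_left [simp]: "cscale s X ** Y = cscale s (X ** Y)"
  by (simp add: vec_eq_iff matrix_matrix_mult_def sum_distrib_left mult_ac)

lemma cscale_mult_right [simp]: "X ** cscale s Y = cscale s (X ** Y)"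
  by (simp add: vec_eq_iff matrix_matrix_mult_def sum_distrib_left mult_ac)

lemma cscale_vec: "cscale s X *v v = s *s (X *v v)"
  by (simp add: vec_eq_iff matrix_vector_mult_def sum_distrib_left mult_ac)

lemma matrix_sum_left: "(\<Sum>i\<in>S. X i :: complex^'n^'n) ** Y = (\<Sum>i\<in>S. X i ** Y)"
  by (induction S rule: infinite_finite_induct)
     (auto simp: vec_eq_iff matrix_matrix_mult_def sum.distrib distrib_right)

lemma matrix_sum_right: "Y ** (\<Sum>i\<in>S. X i :: complex^'n^'n) = (\<Sum>i\<in>S. Y ** X i)"
  by (induction S rule: infinite_finite_induct)
     (auto simp: vec_eq_iff matrix_matrix_mult_def sum.distrib distrib_left)

lemma matrix_diff_left: "(X - Y) ** Z = X ** Z - Y ** (Z :: complex^'n^'n)"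
  by (simp add: vec_eq_iff matrix_matrix_mult_def left_diff_distrib sum_subtractf)

lemma sum_matrix_vec: "(\<Sum>i\<in>S. X i :: complex^'n^'n) *v v = (\<Sum>i\<in>S. X i *v v)"
  by (induction S rule: infinite_finite_induct)
     (auto simp: vec_eq_iff matrix_vector_mult_def sum.distrib distrib_right)

lemma trace_cscale: "trace (cscale s X) = s * trace X"
  by (simp add: trace_def sum_distrib_left)

lemma trace_sum: "trace (\<Sum>i\<in>S. X i :: complex^'n^'n) = (\<Sum>i\<in>S. trace (X i))"
  by (induction S rule: infinite_finite_induct) (auto simp: trace_def sum.distrib)

lemma prod_inverse: "(\<Prod>i\<in>S. inverse (f i :: 'a::field)) = inverse (\<Prod>i\<in>S. f i)"
  using prod_inversef[of f S] by (simp add: comp_def)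

subsection \<open>Characters of a torus\<close>

text \<open>Dedekind's argument. Translating a relation by \<open>y\<close> and subtracting
  \<open>c k y\<close> times the original removes the term of \<open>k\<close>; the induction
  hypothesis applies to the remaining coefficients \<open>a i * (c i y - c k y)\<close>, and
  \<open>y\<close> is chosen to separate \<open>j\<close> from \<open>k\<close>.\<close>

lemma dedekind_independence:
  fixes c :: "'i \<Rightarrow> 'a \<Rightarrow> 'k::field"
  assumes "finite J"
    and S: "\<And>x y. x \<in> S \<Longrightarrow> y \<in> S \<Longrightarrow> f x y \<in> S"
    and hom: "\<And>i x y. i \<in> J \<Longrightarrow> x \<in> S \<Longrightarrow> y \<in> S \<Longrightarrow> c i (f x y) = c i x * c i y"
    and nz: "\<And>i. i \<in> J \<Longrightarrow> \<exists>x\<in>S. c i x \<noteq> 0"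
    and ne: "\<And>i j. i \<in> J \<Longrightarrow> j \<in> J \<Longrightarrow> i \<noteq> j \<Longrightarrow> \<exists>x\<in>S. c i x \<noteq> c j x"
    and "\<And>x. x \<in> S \<Longrightarrow> (\<Sum>i\<in>J. a i * c i x) = 0"
    and "i \<in> J"
  shows "a i = 0"
  using assms(1) hom nz ne assms(6,7)
proof (induction J arbitrary: a i rule: finite_induct)
  case empty
  then show ?case by simp
next
  case (insert k J)
  have J0: "a j = 0" if j: "j \<in> J" for j
  proof -
    from j insert.hyps have "j \<noteq> k" by auto
    with insert.prems(3) j obtain y where y: "y \<in> S" "c j y \<noteq> c k y" by blast
    have "(\<Sum>i\<in>J. a i * (c i y - c k y) * c i x) = 0" if x: "x \<in> S" for x
    proof -
      have 1: "(\<Sum>i\<in>insert k J. a i * c i (f y x)) = 0"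
        using insert.prems(4) S y x by blast
      have "(\<Sum>i\<in>insert k J. a i * c i (f y x)) = (\<Sum>i\<in>insert k J. a i * c i y * c i x)"
        using insert.prems(1)[OF _ y(1) x] by (intro sum.cong) auto
      with 1 have 2: "a k * c k y * c k x + (\<Sum>i\<in>J. a i * c i y * c i x) = 0"
        using insert.hyps by simp
      have 3: "c k y * (a k * c k x + (\<Sum>i\<in>J. a i * c i x)) = 0"
        using insert.prems(4)[OF x] insert.hyps by simp
      show ?thesis
        using 2 3 by (simp add: algebra_simps sum_subtractf sum_distrib_left) (metis add_left_cancel)
    qed
    then have "a j * (c j y - c k y) = 0"
      by (intro insert.IH[where a = "\<lambda>i. a i * (c i y - c k y)"])
         (use insert.prems j in \<open>auto\<close>)
    with y show ?thesis by simp
  qed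
  obtain x where x: "x \<in> S" "c k x \<noteq> 0" using insert.prems(2) by blast
  have "(\<Sum>i\<in>J. a i * c i x) = 0" using J0 by simp
  with insert.prems(4)[OF x(1)] insert.hyps x have "a k = 0" by simp
  with J0 insert.prems(5) show ?case by blast
qed

text \<open>A fixed isomorphism with a standard torus. The diagonal entries of
  \<open>\<phi> t\<close> at indices in \<open>I\<close> serve as coordinates of \<open>t\<close>,
  in which characters become monomials.\<close>

locale torus_chart =
  fixes T :: "(complex^'N^'N) set" and I :: "'N set"
    and \<phi> \<psi> :: "complex^'N^'N \<Rightarrow> complex^'N^'N"
  assumes T: "algebraic_group T"
    and \<phi>: "alg_hom T (diag_torus I) \<phi>" and \<psi>: "alg_hom (diag_torus I) T \<psi>"
    and \<psi>\<phi>: "t \<in> T \<Longrightarrow> \<psi> (\<phi> t) = t" and \<phi>\<psi>: "d \<in> diag_torus I \<Longrightarrow> \<phi> (\<psi> d) = d"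
begin

lemma T_one: "mat 1 \<in> T" and T_mult: "s \<in> T \<Longrightarrow> t \<in> T \<Longrightarrow> s ** t \<in> T"
  using T by (auto simp: algebraic_group_def)

definition monomial :: "('N \<Rightarrow> int) \<Rightarrow> complex^'N^'N \<Rightarrow> complex" where
  "monomial m t = (\<Prod>i\<in>I. \<phi> t $ i $ i powi m i)"

text \<open>Exponents outside \<open>I\<close> do not affect a monomial; fixing them to 0 makes
  distinct vectors give distinct monomials.\<close>

definition exponents :: "('N \<Rightarrow> int) set" where
  "exponents = {m. \<forall>i. i \<notin> I \<longrightarrow> m i = 0}"

definition laurent :: "(complex^'N^'N \<Rightarrow> complex) \<Rightarrow> bool" where
  "laurent f \<longleftrightarrow> (\<exists>C a. finite C \<and> C \<subseteq> exponents \<and> (\<forall>t\<in>T. f t = (\<Sum>m\<in>C. a m * monomial m t)))"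

lemma det_diag_torus: "d \<in> diag_torus I \<Longrightarrow> det d = (\<Prod>i\<in>I. d $ i $ i)"
proof -
  assume d: "d \<in> diag_torus I"
  then have "det d = (\<Prod>i\<in>UNIV. d $ i $ i)"
    by (intro det_diagonal) (auto simp: diag_torus_def)
  also have "\<dots> = (\<Prod>i\<in>I. d $ i $ i)"
    using d by (intro prod.mono_neutral_right) (auto simp: diag_torus_def)
  finally show ?thesis .
qed

lemma phi_diag_torus: "t \<in> T \<Longrightarrow> \<phi> t \<in> diag_torus I"
  using \<phi> by (auto simp: alg_hom_def)

lemma phi_nz: "t \<in> T \<Longrightarrow> i \<in> I \<Longrightarrow> \<phi> t $ i $ i \<noteq> 0"
  using det_diag_torus[OF phi_diag_torus] phi_diag_torus
  by (auto simp: diag_torus_def invertible_det_nz)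

lemma phi_mult: 
  assumes "s \<in> T" "t \<in> T"
  shows "\<phi> (s ** t) $ i $ i = \<phi> s $ i $ i * \<phi> t $ i $ i"
proof -
  have "\<phi> (s ** t) = \<phi> s ** \<phi> t" using assms \<phi> by (simp add: alg_hom_def)
  then have "\<phi> (s ** t) $ i $ i = (\<Sum>k\<in>UNIV. \<phi> s $ i $ k * \<phi> t $ k $ i)"
    by (simp add: matrix_matrix_mult_def)
  also have "\<dots> = (\<Sum>k\<in>UNIV. if k = i then \<phi> s $ i $ i * \<phi> t $ i $ i else 0)"
    using phi_diag_torus[OF assms(1)] by (intro sum.cong) (auto simp: diag_torus_def)
  finally show ?thesis by simp
qed

lemma monomial_nz: "t \<in> T \<Longrightarrow> monomial m t \<noteq> 0"
  using phi_nz by (auto simp: monomial_def)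

lemma monomial_mult: "s \<in> T \<Longrightarrow> t \<in> T \<Longrightarrow> monomial m (s ** t) = monomial m s * monomial m t"
  by (simp add: monomial_def phi_mult power_int_mult_distrib prod.distrib)

lemma monomial_add: "t \<in> T \<Longrightarrow> monomial (\<lambda>i. m i + m' i) t = monomial m t * monomial m' t"
  unfolding monomial_def prod.distrib[symmetric]
  by (intro prod.cong refl power_int_add) (use phi_nz in auto)

lemma monomial_one: "monomial m (mat 1) = 1"
  using monomial_mult[OF T_one T_one, of m] monomial_nz[OF T_one, of m] by simp

lemma phi_one: "i \<in> I \<Longrightarrow> \<phi> (mat 1) $ i $ i = 1"
  using phi_mult[OF T_one T_one, of i] phi_nz[OF T_one, of i] by simp

text \<open>Surjectivity of the chart, the source of all points of \<open>T\<close> with prescribed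
  character values.\<close>

lemma ex_coordinates:
  assumes "\<And>i. i \<in> I \<Longrightarrow> d i \<noteq> 0"
  shows "\<exists>t\<in>T. \<forall>i\<in>I. \<phi> t $ i $ i = d i"
proof -
  define D :: "complex^'N^'N" where
    "D = (\<chi> i j. if i = j then if i \<in> I then d i else 1 else 0)"
  have "det D = (\<Prod>i\<in>UNIV. D $ i $ i)"
    by (rule det_diagonal) (simp add: D_def)
  also have "\<dots> \<noteq> 0" using assms by (auto simp: D_def)
  finally have "D \<in> diag_torus I"
    by (auto simp: diag_torus_def invertible_det_nz D_def)
  then have "\<psi> D \<in> T" "\<phi> (\<psi> D) = D"
    using \<psi> \<phi>\<psi> by (auto simp: alg_hom_def)
  then show ?thesis by (intro bexI[of _ "\<psi> D"]) (auto simp: D_def)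
qed

lemma monomial_distinct:
  assumes "m \<in> exponents" "m' \<in> exponents" "m \<noteq> m'"
  shows "\<exists>t\<in>T. monomial m t \<noteq> monomial m' t"
proof -
  obtain i where i: "m i \<noteq> m' i" using assms(3) by blast
  with assms have iI: "i \<in> I" by (auto simp: exponents_def)
  \<comment> \<open>At the point with coordinate 2 in place \<open>i\<close> and 1 elsewhere, a
    monomial shows just its exponent at \<open>i\<close>, as a power of 2.\<close>
  obtain t where t: "t \<in> T" "\<forall>j\<in>I. \<phi> t $ j $ j = (if j = i then 2 else 1)"
    using ex_coordinates[of "\<lambda>j. if j = i then 2 else 1"] by (metis one_neq_zero zero_neq_numeral)
  have eq: "monomial n t = 2 powi n i" for n
  proof -
    have "monomial n t = (\<Prod>j\<in>I. if j = i then 2 powi n i else 1)"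
      unfolding monomial_def using t(2) by (intro prod.cong) auto
    then show ?thesis using iI by simp
  qed
  have "monomial m t \<noteq> monomial m' t"
  proof
    assume "monomial m t = monomial m' t"
    \<comment> \<open>Norms move the equation to the reals, where powers of 2 determine their
      exponent.\<close>
    then have "norm (2 powi m i :: complex) = norm (2 powi m' i :: complex)" by (simp add: eq)
    then have "(2::real) powi m i = 2 powi m' i" by (simp add: norm_power_int)
    then have "(2::real) powr m i = 2 powr m' i" by (simp add: powr_real_of_int')
    then show False using i by (simp add: powr_inj)
  qed
  with t show ?thesis by blast
qed

lemma monomial_independent:
  assumes "finite C" "C \<subseteq> exponents" "\<And>t. t \<in> T \<Longrightarrow> (\<Sum>m\<in>C. a m * monomial m t) = 0" "m \<in> C"
  shows "a m = 0"
  by (rule dedekind_independence[where S = T and f = "(**)" and c = monomial and J = C])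
     (use assms T_mult monomial_mult monomial_distinct monomial_nz T_one in \<open>blast+\<close>)

section \<open>Laurent polynomials on the torus\<close>

lemma laurent_cong: "(\<And>t. t \<in> T \<Longrightarrow> f t = g t) \<Longrightarrow> laurent f = laurent g"
  unfolding laurent_def by auto

lemma laurent_zero: "laurent (\<lambda>_. 0)"
  unfolding laurent_def by (rule exI[of _ "{}"]) auto

lemma laurent_cmono: "m \<in> exponents \<Longrightarrow> laurent (\<lambda>t. c * monomial m t)"
  unfolding laurent_def by (rule exI[of _ "{m}"], rule exI[of _ "\<lambda>_. c"]) auto

lemma laurent_add:
  assumes "laurent f" "laurent g"
  shows "laurent (\<lambda>t. f t + g t)"
proof -
  obtain C a where C: "finite C" "C \<subseteq> exponents" "\<And>t. t \<in> T \<Longrightarrow> f t = (\<Sum>m\<in>C. a m * monomial m t)"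
    using assms(1) unfolding laurent_def by blast
  obtain D b where D: "finite D" "D \<subseteq> exponents" "\<And>t. t \<in> T \<Longrightarrow> g t = (\<Sum>m\<in>D. b m * monomial m t)"
    using assms(2) unfolding laurent_def by blast
  \<comment> \<open>Both coefficient families are extended by 0 to the union of their index
    sets.\<close>
  define e where "e m = (if m \<in> C then a m else 0) + (if m \<in> D then b m else 0)" for m
  have "f t + g t = (\<Sum>m\<in>C \<union> D. e m * monomial m t)" if t: "t \<in> T" for t
  proof -
    have "f t = (\<Sum>m\<in>C \<union> D. (if m \<in> C then a m else 0) * monomial m t)"
      unfolding C(3)[OF t] by (rule sum.mono_neutral_cong_left) (use C(1) D(1) in auto)
    moreover have "g t = (\<Sum>m\<in>C \<union> D. (if m \<in> D then b m else 0) * monomial m t)"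
      unfolding D(3)[OF t] by (rule sum.mono_neutral_cong_left) (use C(1) D(1) in auto)
    ultimately show ?thesis by (simp add: e_def distrib_right sum.distrib)
  qed
  with C(1,2) D(1,2) show ?thesis
    unfolding laurent_def by (intro exI[of _ "C \<union> D"] exI[of _ e] conjI ballI) simp_all
qed

lemma laurent_sum: "(\<And>i. i \<in> S \<Longrightarrow> laurent (f i)) \<Longrightarrow> laurent (\<lambda>t. \<Sum>i\<in>S. f i t)"
  by (induction S rule: infinite_finite_induct) (auto intro: laurent_zero laurent_add)

lemma exponents_add: "m \<in> exponents \<Longrightarrow> m' \<in> exponents \<Longrightarrow> (\<lambda>i. m i + m' i) \<in> exponents"
  by (simp add: exponents_def)

lemma laurent_mult:
  assumes "laurent f" "laurent g"
  shows "laurent (\<lambda>t. f t * g t)"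
proof -
  obtain C a where C: "finite C" "C \<subseteq> exponents" "\<And>t. t \<in> T \<Longrightarrow> f t = (\<Sum>m\<in>C. a m * monomial m t)"
    using assms(1) unfolding laurent_def by blast
  obtain D b where D: "finite D" "D \<subseteq> exponents" "\<And>t. t \<in> T \<Longrightarrow> g t = (\<Sum>m\<in>D. b m * monomial m t)"
    using assms(2) unfolding laurent_def by blast
  have "laurent (\<lambda>t. \<Sum>m\<in>C. \<Sum>m'\<in>D. (a m * b m') * monomial (\<lambda>i. m i + m' i) t)"
    using C(2) D(2) by (intro laurent_sum laurent_cmono exponents_add) auto
  then show ?thesis
    by (rule laurent_cong[THEN iffD1, rotated])
       (simp add: C D monomial_add sum_product mult_ac)
qed

lemma laurent_const: "laurent (\<lambda>_. c)"
  using laurent_cmono[of "\<lambda>_. 0" c] by (simp add: exponents_def monomial_def)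

lemma laurent_coordinate: "laurent (\<lambda>t. \<phi> t $ i $ j)"
proof (cases "i = j")
  case False
  then show ?thesis
    using phi_diag_torus by (intro laurent_cong[THEN iffD2, OF _ laurent_zero]) (auto simp: diag_torus_def)
next
  case True
  show ?thesis
  proof (cases "i \<in> I")
    case False
    then show ?thesis using phi_diag_torus True
      by (intro laurent_cong[THEN iffD2, OF _ laurent_const[of 1]]) (auto simp: diag_torus_def)
  next
    case iI: True
    define m where "m k = (if k = i then 1 else 0 :: int)" for k
    have "monomial m t = \<phi> t $ i $ i" for t
    proof -
      have "monomial m t = (\<Prod>j\<in>I. if j = i then \<phi> t $ i $ i else 1)"
        unfolding monomial_def m_def by (intro prod.cong) auto
      then show ?thesis using iI by simp
    qed
    moreover have "m \<in> exponents" using iI by (auto simp: m_def exponents_def)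
    ultimately show ?thesis using laurent_cmono[of m 1] True by simp
  qed
qed

lemma laurent_polyfun:
  assumes "polyfun p" "\<And>i j. laurent (\<lambda>t. \<sigma> t $ i $ j)"
  shows "laurent (\<lambda>t. p (\<sigma> t))"
  using assms by induction (auto intro: laurent_const laurent_add laurent_mult)

text \<open>Since \<open>\<psi> (\<phi> t) = t\<close>, an entry of \<open>t\<close> is a regular
  function of the diagonal matrix \<open>\<phi> t\<close>, and there the negative powers of the
  determinant are themselves monomials.\<close>

lemma laurent_entry: "laurent (\<lambda>t. t $ a $ b)"
proof -
  obtain F where F: "regular_GL F" "\<And>d. d \<in> diag_torus I \<Longrightarrow> \<psi> d $ a $ b = F d"
    using \<psi> unfolding alg_hom_def regular_on_def by blast
  obtain p k where p: "polyfun p" "\<And>d. invertible d \<Longrightarrow> F d = p d / det d ^ k"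
    using F(1) unfolding regular_GL_def by blast
  \<comment> \<open>The exponent vector of det^(-k): on the standard torus the determinant is the
    product of the coordinates in \<open>I\<close>.\<close>
  define m where "m i = (if i \<in> I then - int k else 0)" for i
  have "t $ a $ b = p (\<phi> t) * (1 * monomial m t)" if t: "t \<in> T" for t
  proof -
    have "monomial m t = (\<Prod>i\<in>I. inverse (\<phi> t $ i $ i) ^ k)"
      unfolding monomial_def m_def by (intro prod.cong) (auto simp: power_int_minus power_inverse)
    also have "\<dots> = 1 / det (\<phi> t) ^ k"
      by (simp add: det_diag_torus[OF phi_diag_torus[OF t]] power_inverse divide_inverse
          prod_power_distrib flip: prod_inverse)
    finally have "p (\<phi> t) * (1 * monomial m t) = F (\<phi> t)"
      using p(2)[of "\<phi> t"] phi_diag_torus[OF t] by (simp add: diag_torus_def)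
    also have "\<dots> = t $ a $ b" using F(2)[OF phi_diag_torus[OF t]] \<psi>\<phi>[OF t] by simp
    finally show ?thesis by simp
  qed
  moreover have "laurent (\<lambda>t. p (\<phi> t) * (1 * monomial m t))"
    by (intro laurent_mult laurent_polyfun[OF p(1)] laurent_coordinate laurent_cmono)
       (simp add: exponents_def m_def)
  ultimately show ?thesis by (simp cong: laurent_cong)
qed

text \<open>Comparing coefficients of the monomials in \<open>u\<close> in f(tu) = f(t) f(u) gives
  \<open>a m * (monomial m t - f t) = 0\<close>. Hence \<open>f\<close> equals any monomial that
  occurs in it with nonzero coefficient.\<close>

lemma laurent_multiplicative:
  assumes f: "laurent f" and hom: "\<And>s t. s \<in> T \<Longrightarrow> t \<in> T \<Longrightarrow> f (s ** t) = f s * f t"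
    and "s \<in> T" "f s \<noteq> 0"
  shows "\<exists>m\<in>exponents. \<forall>t\<in>T. f t = monomial m t"
proof -
  obtain C a where C: "finite C" "C \<subseteq> exponents" "\<And>t. t \<in> T \<Longrightarrow> f t = (\<Sum>m\<in>C. a m * monomial m t)"
    using f unfolding laurent_def by blast
  have "(\<Sum>m\<in>C. a m * monomial m s) \<noteq> 0" using C(3)[OF assms(3)] assms(4) by simp
  then obtain m where "m \<in> C" "a m * monomial m s \<noteq> 0" by (rule sum.not_neutral_contains_not_neutral)
  then obtain m where m: "m \<in> C" "a m \<noteq> 0" by simp
  have "f t = monomial m t" if t: "t \<in> T" for t
  proof -
    have "(\<Sum>m\<in>C. (a m * (monomial m t - f t)) * monomial m u) = 0" if u: "u \<in> T" for u
    proof -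
      have "(\<Sum>m\<in>C. a m * monomial m (t ** u)) = f t * (\<Sum>m\<in>C. a m * monomial m u)"
        using C(3)[OF T_mult[OF t u]] C(3)[OF u] hom[OF t u] by simp
      then show ?thesis
        using t u by (simp add: monomial_mult algebra_simps sum_subtractf sum_distrib_left)
    qed
    from monomial_independent[OF C(1,2) this m(1)] m show ?thesis by simp
  qed
  with m C show ?thesis by blast
qed

text \<open>Makes the determinant of \<open>t\<close> itself, not only that of
  \<open>\<phi> t\<close>, invertible among Laurent polynomials. That is what the denominators of
  regular functions on \<open>T\<close> call for.\<close>

lemma det_monomial: "\<exists>m\<in>exponents. \<forall>t\<in>T. det t = monomial m t"
  by (rule laurent_multiplicative[where s = "mat 1"])
     (auto intro: laurent_polyfun[OF polyfun_det] laurent_entry T_one simp: det_mul)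

lemma laurent_regular:
  assumes "regular_on T f"
  shows "laurent f"
proof -
  obtain F where F: "regular_GL F" "\<And>d. d \<in> T \<Longrightarrow> f d = F d"
    using assms unfolding regular_on_def by blast
  obtain p k where p: "polyfun p" "\<And>d. invertible d \<Longrightarrow> F d = p d / det d ^ k"
    using F(1) unfolding regular_GL_def by blast
  obtain m where m: "m \<in> exponents" "\<And>t. t \<in> T \<Longrightarrow> det t = monomial m t"
    using det_monomial by blast
  have "monomial (\<lambda>i. - int k * m i) t = 1 / det t ^ k" if t: "t \<in> T" for t
  proof -
    have "monomial (\<lambda>i. - int k * m i) t = (\<Prod>i\<in>I. inverse ((\<phi> t $ i $ i powi m i) ^ k))"
      unfolding monomial_def
      by (intro prod.cong refl) (simp add: power_int_minus power_int_power' mult.commute)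
    also have "\<dots> = 1 / det t ^ k"
      by (simp add: m(2)[OF t] monomial_def divide_inverse prod_power_distrib flip: prod_inverse)
    finally show ?thesis .
  qed
  then have "f t = p t * (1 * monomial (\<lambda>i. - int k * m i) t)" if "t \<in> T" for t
    using p(2)[of t] F(2) that algebraic_group_GL[OF T] by auto
  moreover have "laurent (\<lambda>t. p t * (1 * monomial (\<lambda>i. - int k * m i) t))"
    by (intro laurent_mult laurent_polyfun[OF p(1)] laurent_entry laurent_cmono)
       (use m in \<open>simp add: exponents_def\<close>)
  ultimately show ?thesis by (simp cong: laurent_cong)
qed

lemma character_monomial:
  assumes "\<xi> \<in> characters T"
  shows "\<exists>m\<in>exponents. \<forall>t\<in>T. \<xi> t = monomial m t"
  by (rule laurent_multiplicative[where s = "mat 1"])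
     (use assms T_one laurent_regular in \<open>auto simp: characters_def\<close>)

section \<open>Differentials of characters and exponentials\<close>

lemma regular_coordinate: "regular_on T (\<lambda>t. \<phi> t $ i $ j)"
  using \<phi> by (simp add: alg_hom_def)

text \<open>Multiplying by the monomial of the negative parts of the exponents leaves an identity
  between products of natural powers, to which the Leibniz rule applies.\<close>

lemma differential_monomial:
  assumes X: "X \<in> lie_algebra T" and \<xi>: "regular_on T \<xi>" "\<And>t. t \<in> T \<Longrightarrow> \<xi> t = monomial m t"
  shows "differential T \<xi> X = (\<Sum>i\<in>I. of_int (m i) * differential T (\<lambda>t. \<phi> t $ i $ i) X)"
proof -
  let ?D = "\<lambda>i. differential T (\<lambda>t. \<phi> t $ i $ i) X"
  let ?M = "\<lambda>k t. \<Prod>i\<in>I. (\<phi> t $ i $ i) ^ k i"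
  have reg: "regular_on T (?M k)" for k
    by (intro regular_on_prod regular_on_power regular_coordinate)
  have dM: "differential T (?M k) X = (\<Sum>i\<in>I. of_nat (k i) * ?D i)" for k
    by (subst differential_prod[OF T X])
       (auto simp: phi_one differential_power[OF T X] regular_on_power regular_coordinate)
  have "\<xi> t * ?M (\<lambda>i. nat (- m i)) t = ?M (\<lambda>i. nat (m i)) t" if t: "t \<in> T" for t
    unfolding \<xi>(2)[OF t] monomial_def prod.distrib[symmetric]
  proof (intro prod.cong refl)
    fix i assume "i \<in> I"
    with t phi_nz have nz: "\<phi> t $ i $ i \<noteq> 0" by blast
    show "\<phi> t $ i $ i powi m i * \<phi> t $ i $ i ^ nat (- m i) = \<phi> t $ i $ i ^ nat (m i)"
      using nz by (auto simp: power_int_def power_inverse)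
  qed
  then have "differential T (\<lambda>t. \<xi> t * ?M (\<lambda>i. nat (- m i)) t) X
      = differential T (?M (\<lambda>i. nat (m i))) X"
    by (rule differential_cong)
  then have "differential T \<xi> X + (\<Sum>i\<in>I. of_nat (nat (- m i)) * ?D i)
      = (\<Sum>i\<in>I. of_nat (nat (m i)) * ?D i)"
    using \<xi>(2)[OF T_one]
    by (simp add: differential_mult[OF T X \<xi>(1) reg] dM phi_one monomial_one)
  then have "differential T \<xi> X = (\<Sum>i\<in>I. of_nat (nat (m i)) * ?D i - of_nat (nat (- m i)) * ?D i)"
    by (simp add: sum_subtractf algebra_simps)
  also have "\<dots> = (\<Sum>i\<in>I. of_int (m i) * ?D i)"
  proof (intro sum.cong refl)
    fix i
    have "(of_int (m i) :: complex) = of_nat (nat (m i)) - of_nat (nat (- m i))"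
      by (cases "m i \<ge> 0") auto
    then show "of_nat (nat (m i)) * ?D i - of_nat (nat (- m i)) * ?D i = of_int (m i) * ?D i"
      by (simp add: left_diff_distrib)
  qed
  finally show ?thesis .
qed

text \<open>
  A character is a monomial with integer exponents in the coordinates, so its differential commutes
  with any real-linear \<open>L\<close> on \<open>\<complex>\<close>. Both multiplication by a scalar and \<open>L z = Im z\<close> are used.
\<close>

lemma exponential:
  assumes X: "X \<in> lie_algebra T" and L: "linear L"
  shows "\<exists>t\<in>T. \<forall>\<xi>\<in>characters T. \<xi> t = exp (L (differential T \<xi> X))"
proof -
  let ?D = "\<lambda>i. differential T (\<lambda>t. \<phi> t $ i $ i) X"
  obtain t where t: "t \<in> T" "\<forall>i\<in>I. \<phi> t $ i $ i = exp (L (?D i))"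
    using ex_coordinates[of "\<lambda>i. exp (L (?D i))"] by auto
  have "\<xi> t = exp (L (differential T \<xi> X))" if \<xi>: "\<xi> \<in> characters T" for \<xi>
  proof -
    obtain m where m: "\<And>t. t \<in> T \<Longrightarrow> \<xi> t = monomial m t" using character_monomial[OF \<xi>] by blast
    have "L (of_int k * z) = of_int k * L z" for k z
      using linear_cmul[OF L, of "of_int k" z] by (simp add: scaleR_conv_of_real)
    then have "L (differential T \<xi> X) = (\<Sum>i\<in>I. of_int (m i) * L (?D i))"
      using \<xi> by (subst differential_monomial[OF X _ m])
        (auto simp: characters_def linear_sum[OF L])
    then have "exp (L (differential T \<xi> X)) = (\<Prod>i\<in>I. exp (of_int (m i) * L (?D i)))"
      by (simp add: exp_sum)
    also have "\<dots> = monomial m t"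
      unfolding monomial_def using t by (intro prod.cong refl) (simp add: exp_power_int mult.commute)
    finally show ?thesis using m[OF t(1)] by simp
  qed
  with t show ?thesis by blast
qed

end

subsection \<open>Weight space decomposition\<close>

text \<open>\<open>A \<xi>\<close> plays the role of the projector onto the weight space of
  \<open>\<xi>\<close>, and \<open>C\<close> that of the set of weights;
  \<open>weight_space_eq\<close> and \<open>weights_eq\<close> confirm this.\<close>

definition spectral_decomposition ::
  "(complex^'N^'N) set \<Rightarrow> (complex^'N^'N \<Rightarrow> complex^'v^'v) \<Rightarrow>
   (complex^'N^'N \<Rightarrow> complex) set \<Rightarrow> ((complex^'N^'N \<Rightarrow> complex) \<Rightarrow> complex^'v^'v) \<Rightarrow> bool" where
  "spectral_decomposition T \<sigma> C A \<longleftrightarrow> finite C \<and> C \<subseteq> characters T \<and>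
     (\<forall>\<xi>\<in>C. A \<xi> \<noteq> 0) \<and> (\<forall>\<xi>\<in>C. \<forall>\<eta>\<in>C. A \<xi> ** A \<eta> = (if \<xi> = \<eta> then A \<xi> else 0)) \<and>
     (\<Sum>\<xi>\<in>C. A \<xi>) = mat 1 \<and> (\<forall>t\<in>T. \<sigma> t = (\<Sum>\<xi>\<in>C. cscale (\<xi> t) (A \<xi>)))"

context torus_chart
begin

lemma monomial_independent_matrix:
  fixes M :: "('N \<Rightarrow> int) \<Rightarrow> complex^'v^'v"
  assumes "finite C" "C \<subseteq> exponents"
    and "\<And>t. t \<in> T \<Longrightarrow> (\<Sum>m\<in>C. cscale (monomial m t) (M m)) = 0" and "m \<in> C"
  shows "M m = 0"
proof -
  have "M m $ a $ b = 0" for a b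
  proof (rule monomial_independent[OF assms(1,2) _ assms(4)])
    fix t assume "t \<in> T"
    from assms(3)[OF this] have "(\<Sum>m\<in>C. cscale (monomial m t) (M m)) $ a $ b = 0" by simp
    then show "(\<Sum>m\<in>C. M m $ a $ b * monomial m t) = 0" by (simp add: mult.commute)
  qed
  then show ?thesis by (simp add: vec_eq_iff)
qed

text \<open>The entries have separate finite expansions; over the union of their index sets, the
  coefficients at one monomial assemble into a matrix.\<close>

lemma laurent_matrix:
  fixes \<sigma> :: "complex^'N^'N \<Rightarrow> complex^'v^'v"
  assumes "\<And>a b. laurent (\<lambda>t. \<sigma> t $ a $ b)"
  shows "\<exists>C M. finite C \<and> C \<subseteq> exponents \<and> (\<forall>m\<in>C. M m \<noteq> 0) \<and>
           (\<forall>t\<in>T. \<sigma> t = (\<Sum>m\<in>C. cscale (monomial m t) (M m)))"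
proof -
  have "\<exists>Cc. finite (fst Cc) \<and> fst Cc \<subseteq> exponents \<and>
      (\<forall>t\<in>T. \<sigma> t $ fst ab $ snd ab = (\<Sum>m\<in>fst Cc. snd Cc m * monomial m t))" for ab
    using assms[of "fst ab" "snd ab"] unfolding laurent_def by auto
  then have "\<forall>ab. \<exists>Cc. finite (fst Cc) \<and> fst Cc \<subseteq> exponents \<and>
      (\<forall>t\<in>T. \<sigma> t $ fst ab $ snd ab = (\<Sum>m\<in>fst Cc. snd Cc m * monomial m t))"
    by blast
  from choice[OF this] obtain Cc where Cc0: "\<forall>ab. finite (fst (Cc ab)) \<and> fst (Cc ab) \<subseteq> exponents \<and>
      (\<forall>t\<in>T. \<sigma> t $ fst ab $ snd ab = (\<Sum>m\<in>fst (Cc ab). snd (Cc ab) m * monomial m t))"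
    by blast
  then have Cc: "\<And>ab. finite (fst (Cc ab))" "\<And>ab. fst (Cc ab) \<subseteq> exponents"
    "\<And>ab t. t \<in> T \<Longrightarrow> \<sigma> t $ fst ab $ snd ab = (\<Sum>m\<in>fst (Cc ab). snd (Cc ab) m * monomial m t)"
    by blast+
  define C where "C = (\<Union>ab. fst (Cc ab))"
  define M :: "('N \<Rightarrow> int) \<Rightarrow> complex^'v^'v" where
    "M m = (\<chi> a b. if m \<in> fst (Cc (a, b)) then snd (Cc (a, b)) m else 0)" for m
  have C: "finite C" "C \<subseteq> exponents" unfolding C_def using Cc(1,2) by (simp, blast)
  have "\<sigma> t = (\<Sum>m\<in>C. cscale (monomial m t) (M m))" if t: "t \<in> T" for t
  proof -
    have "\<sigma> t $ a $ b = (\<Sum>m\<in>C. monomial m t * M m $ a $ b)" for a b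
      using Cc(3)[OF t, of "(a, b)"] C(1)
      by (simp add: M_def C_def) (rule sum.mono_neutral_cong_left, auto)
    then show ?thesis by (simp add: vec_eq_iff)
  qed
  \<comment> \<open>Discarding the zero coefficient matrices leaves only monomials that occur, so
    that each will be a weight.\<close>
  moreover have "(\<Sum>m\<in>C. cscale (monomial m t) (M m)) =
      (\<Sum>m\<in>{m \<in> C. M m \<noteq> 0}. cscale (monomial m t) (M m))" for t
    using C(1) by (intro sum.mono_neutral_right) auto
  ultimately show ?thesis
    using C by (intro exI[of _ "{m \<in> C. M m \<noteq> 0}"] exI[of _ M]) auto
qed

text \<open>
  Comparing the coefficients of the characters in \<open>\<sigma>(s t) = \<sigma>(s) \<sigma>(t)\<close>, first as functions of \<open>t\<close> and
  then of \<open>s\<close>, shows that the coefficient matrices of \<open>\<sigma>\<close> are orthogonal idempotents.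
\<close>

lemma alg_hom_decomposition:
  fixes \<sigma> :: "complex^'N^'N \<Rightarrow> complex^'v^'v"
  assumes \<sigma>: "alg_hom T GL \<sigma>"
  shows "\<exists>C A. spectral_decomposition T \<sigma> C A"
proof -
  have reg: "regular_on T (\<lambda>t. \<sigma> t $ a $ b)" for a b
    using \<sigma> by (simp add: alg_hom_def)
  have hom: "\<sigma> (s ** t) = \<sigma> s ** \<sigma> t" if "s \<in> T" "t \<in> T" for s t
    using \<sigma> that by (simp add: alg_hom_def)
  have "laurent (\<lambda>t. \<sigma> t $ a $ b)" for a b by (rule laurent_regular[OF reg])
  from laurent_matrix[of \<sigma>, OF this] obtain C M where
    CM: "finite C \<and> C \<subseteq> exponents \<and> (\<forall>m\<in>C. M m \<noteq> 0) \<and>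
      (\<forall>t\<in>T. \<sigma> t = (\<Sum>m\<in>C. cscale (monomial m t) (M m)))"
    by (elim exE)
  then have C: "finite C" "C \<subseteq> exponents" and nz: "\<And>m. m \<in> C \<Longrightarrow> M m \<noteq> 0"
    and \<sigma>_eq: "\<And>t. t \<in> T \<Longrightarrow> \<sigma> t = (\<Sum>m\<in>C. cscale (monomial m t) (M m))"
    by blast+
  have \<sigma>M: "\<sigma> s ** M m = cscale (monomial m s) (M m)" if s: "s \<in> T" and m: "m \<in> C" for s m
  proof -
    have "(\<Sum>m\<in>C. cscale (monomial m t) (\<sigma> s ** M m - cscale (monomial m s) (M m))) = 0"
      if t: "t \<in> T" for t
    proof -
      have "\<sigma> s ** \<sigma> t = (\<Sum>m\<in>C. cscale (monomial m t) (\<sigma> s ** M m))"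
        by (simp add: \<sigma>_eq[OF t] matrix_sum_right)
      moreover have "\<sigma> (s ** t) = (\<Sum>m\<in>C. cscale (monomial m t) (cscale (monomial m s) (M m)))"
        using s t by (simp add: \<sigma>_eq T_mult monomial_mult mult.commute)
      ultimately have "(\<Sum>m\<in>C. cscale (monomial m t) (\<sigma> s ** M m)) -
         (\<Sum>m\<in>C. cscale (monomial m t) (cscale (monomial m s) (M m))) = 0"
        using hom[OF s t] by simp
      then show ?thesis
        by (simp add: vec_eq_iff algebra_simps sum_subtractf)
    qed
    from monomial_independent_matrix[OF C this m] show ?thesis by simp
  qed
  have orth: "M m' ** M m = (if m' = m then M m else 0)" if m: "m \<in> C" "m' \<in> C" for m m'
  proof -
    have "(\<Sum>m'\<in>C. cscale (monomial m' s) (M m' ** M m - (if m' = m then M m else 0))) = 0"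
      if s: "s \<in> T" for s
    proof -
      have "(\<Sum>m'\<in>C. cscale (monomial m' s) (M m' ** M m)) = \<sigma> s ** M m"
        by (simp add: \<sigma>_eq[OF s] matrix_sum_left)
      moreover have "(\<Sum>m'\<in>C. cscale (monomial m' s) (if m' = m then M m else 0)) = cscale (monomial m s) (M m)"
        using C(1) m(1) by (subst sum.remove[of _ m]) auto
      moreover have "cscale a (X - Y) = cscale a X - cscale a Y" for a and X Y :: "complex^'v^'v"
        by (simp add: vec_eq_iff algebra_simps)
      ultimately show ?thesis using \<sigma>M[OF s m(1)] by (simp add: sum_subtractf)
    qed
    from monomial_independent_matrix[OF C this m(2)] show ?thesis by (simp split: if_splits)
  qed
  \<comment> \<open>An invertible idempotent is the identity.\<close>
  have "\<sigma> (mat 1) = mat 1"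
  proof -
    have "invertible (\<sigma> (mat 1))" using \<sigma> T_one by (auto simp: alg_hom_def)
    then obtain B where "B ** \<sigma> (mat 1) = mat 1" unfolding invertible_def by blast
    moreover have "\<sigma> (mat 1) = \<sigma> (mat 1) ** \<sigma> (mat 1)"
      using hom[OF T_one T_one] by simp
    ultimately show ?thesis by (metis matrix_mul_assoc matrix_mul_lid)
  qed
  then have one: "(\<Sum>m\<in>C. M m) = mat 1"
    by (simp add: \<sigma>_eq[OF T_one] monomial_one)
  \<comment> \<open>Members of \<open>characters T\<close> are extensional, hence the
    restriction.\<close>
  let ?r = "\<lambda>m. restrict (monomial m) T"
  have char: "?r m \<in> characters T" if m: "m \<in> C" for m
  proof -
    \<comment> \<open>By \<open>\<sigma>M\<close>, a nonzero entry of \<open>M m\<close> exhibits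
      the monomial as a linear combination of entries of \<open>\<sigma>\<close>; this gives its
      regularity.\<close>
    obtain a b where ab: "M m $ a $ b \<noteq> 0" using nz[OF m] by (auto simp: vec_eq_iff)
    have "monomial m t = inverse (M m $ a $ b) * (\<Sum>k\<in>UNIV. M m $ k $ b * \<sigma> t $ a $ k)" if "t \<in> T" for t
    proof -
      have "(\<sigma> t ** M m) $ a $ b = monomial m t * M m $ a $ b" using \<sigma>M[OF that m] by simp
      then show ?thesis using ab by (simp add: matrix_matrix_mult_def field_simps)
    qed
    moreover have "regular_on T (\<lambda>t. inverse (M m $ a $ b) * (\<Sum>k\<in>UNIV. M m $ k $ b * \<sigma> t $ a $ k))"
      by (intro regular_on_mult regular_on_sum regular_on_const reg)
    ultimately have "regular_on T (?r m)" by (simp cong: regular_on_cong)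
    then show ?thesis by (simp add: characters_def monomial_nz monomial_mult T_mult)
  qed
  have inj: "inj_on ?r C"
  proof (rule inj_onI, rule ccontr)
    fix m m' assume m: "m \<in> C" "m' \<in> C" "?r m = ?r m'" "m \<noteq> m'"
    with monomial_distinct[of m m'] C(2) obtain t where "t \<in> T" "monomial m t \<noteq> monomial m' t" by blast
    with m(3) show False by (metis restrict_apply')
  qed
  \<comment> \<open>Reindexes the coefficient matrices from exponent vectors to characters,
    unambiguously by \<open>inj\<close>.\<close>
  define A where "A \<xi> = M (inv_into C ?r \<xi>)" for \<xi>
  have A: "A (?r m) = M m" if "m \<in> C" for m 
    using inv_into_f_f[OF inj that] by (simp only: A_def)
  have "spectral_decomposition T \<sigma> (?r ` C) A"
    unfolding spectral_decomposition_def
  proof (intro conjI ballI)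
    show "finite (?r ` C)" using C(1) by simp
    show "?r ` C \<subseteq> characters T" using char by blast
    show "A \<xi> \<noteq> 0" if "\<xi> \<in> ?r ` C" for \<xi>
    proof -
      from that obtain m where "m \<in> C" "\<xi> = ?r m" by blast
      then show ?thesis using nz A by simp
    qed
    show "A \<xi> ** A \<eta> = (if \<xi> = \<eta> then A \<xi> else 0)" if "\<xi> \<in> ?r ` C" "\<eta> \<in> ?r ` C" for \<xi> \<eta>
    proof -
      from that obtain m m' where m: "m \<in> C" "m' \<in> C" "\<xi> = ?r m" "\<eta> = ?r m'" by blast
      show ?thesis
        unfolding m(3,4) A[OF m(1)] A[OF m(2)] inj_on_eq_iff[OF inj m(1,2)] orth[OF m(2,1)] by simp
    qed
    show "(\<Sum>\<xi>\<in>?r ` C. A \<xi>) = mat 1"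
      unfolding sum.reindex[OF inj] one[symmetric] by (rule sum.cong) (simp_all add: A)
    show "\<sigma> t = (\<Sum>\<xi>\<in>?r ` C. cscale (\<xi> t) (A \<xi>))" if "t \<in> T" for t
      unfolding sum.reindex[OF inj] \<sigma>_eq[OF that] by (rule sum.cong) (simp_all add: A that)
  qed
  then show ?thesis by blast
qed

end

lemma torus_of_rank_chart:
  assumes "torus_of_rank n T"
  obtains I \<phi> \<psi> where "torus_chart T I \<phi> \<psi>"
  using assms unfolding torus_of_rank_def torus_chart_def by blast

text \<open>Bases of the image and of the kernel of an idempotent form together a basis of the whole
  space, in which the matrix is diagonal with entries 1 and 0. Traces of weight projectors thereby
  become multiplicities.\<close>

lemma idempotent_trace:
  fixes A :: "complex^'v^'v"
  assumes A: "A ** A = A"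
  shows "trace A = of_nat (vec.dim (range ((*v) A)))"
proof -
  let ?R = "range ((*v) A)" and ?K = "{v. A *v v = 0}"
  have fixR: "A *v v = v" if "v \<in> ?R" for v
    using that A by (auto simp: matrix_vector_mul_assoc)
  obtain B1 where B1: "B1 \<subseteq> ?R" "vec.independent B1" "?R \<subseteq> vec.span B1" "card B1 = vec.dim ?R"
    by (rule vec.basis_exists[of ?R])
  obtain B2 where B2: "B2 \<subseteq> ?K" "vec.independent B2" "?K \<subseteq> vec.span B2" "card B2 = vec.dim ?K"
    by (rule vec.basis_exists[of ?K])
  have fin: "finite B1" "finite B2" using vec.finiteI_independent[OF B1(2)] vec.finiteI_independent[OF B2(2)] by auto
  have disj: "B1 \<inter> B2 = {}"
  proof -
    have "v = 0" if "v \<in> B1" "v \<in> B2" for v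
    proof -
      have "A *v v = v" using that(1) B1(1) fixR by blast
      moreover have "A *v v = 0" using that(2) B2(1) by blast
      ultimately show ?thesis by simp
    qed
    moreover have "0 \<notin> B1" using B1(2) vec.dependent_zero by metis
    ultimately show ?thesis by blast
  qed
  have indep: "vec.independent (B1 \<union> B2)"
  proof (rule vec.independent_if_scalars_zero)
    show "finite (B1 \<union> B2)" using fin by simp
    fix f v assume f: "(\<Sum>x\<in>B1 \<union> B2. f x *s x) = 0" and v: "v \<in> B1 \<union> B2"
    have s: "(\<Sum>x\<in>B1. f x *s x) + (\<Sum>x\<in>B2. f x *s x) = 0"
      using f fin disj by (simp add: sum.union_disjoint)
    have "A *v (\<Sum>x\<in>B1. f x *s x) = (\<Sum>x\<in>B1. f x *s (A *v x))"
      by (simp add: vec.linear_sum[OF matrix_vector_mul_linear_gen] vec.linear_scale[OF matrix_vector_mul_linear_gen])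
    also have "\<dots> = (\<Sum>x\<in>B1. f x *s x)"
    proof (intro sum.cong refl)
      fix x assume "x \<in> B1"
      then have "A *v x = x" using B1(1) fixR by blast
      then show "f x *s (A *v x) = f x *s x" by simp
    qed
    finally have 1: "A *v (\<Sum>x\<in>B1. f x *s x) = (\<Sum>x\<in>B1. f x *s x)" .
    have "A *v (\<Sum>x\<in>B2. f x *s x) = (\<Sum>x\<in>B2. f x *s (A *v x))"
      by (simp add: vec.linear_sum[OF matrix_vector_mul_linear_gen] vec.linear_scale[OF matrix_vector_mul_linear_gen])
    also have "\<dots> = 0"
      using B2(1) by (intro sum.neutral) auto
    finally have 2: "A *v (\<Sum>x\<in>B2. f x *s x) = 0" .
    have "A *v ((\<Sum>x\<in>B1. f x *s x) + (\<Sum>x\<in>B2. f x *s x)) = 0" using s by simp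
    then have z1: "(\<Sum>x\<in>B1. f x *s x) = 0"
      using 1 2 by (simp add: matrix_vector_right_distrib)
    with s have z2: "(\<Sum>x\<in>B2. f x *s x) = 0" by simp
    show "f v = 0"
      using v vec.independentD[OF B1(2) fin(1) order_refl z1] vec.independentD[OF B2(2) fin(2) order_refl z2]
      by blast
  qed
  have span: "vec.span (B1 \<union> B2) = UNIV"
  proof -
    have "v \<in> vec.span (B1 \<union> B2)" for v
    proof -
      have "A *v v \<in> vec.span (B1 \<union> B2)"
        using B1(3) vec.span_mono[of B1 "B1 \<union> B2"] by blast
      moreover have "v - A *v v \<in> ?K"
        using A by (simp add: vec.linear_diff[OF matrix_vector_mul_linear_gen] matrix_vector_mul_assoc)
      then have "v - A *v v \<in> vec.span (B1 \<union> B2)"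
        using B2(3) vec.span_mono[of B2 "B1 \<union> B2"] by blast
      ultimately have "A *v v + (v - A *v v) \<in> vec.span (B1 \<union> B2)" by (rule vec.span_add)
      then show ?thesis by simp
    qed
    then show ?thesis by blast
  qed
  have "card (B1 \<union> B2) = vec.dim (UNIV :: (complex^'v) set)"
    using vec.dim_eq_card[OF _ indep, of UNIV] span by simp
  then have "card (B1 \<union> B2) = CARD('v)" by (simp add: vec.dim_UNIV vec.dimension_def card_cart_basis)
  \<comment> \<open>The basis has as many elements as there are coordinates, so it can be listed by
    column index.\<close>
  then obtain f where f: "bij_betw f (UNIV :: 'v set) (B1 \<union> B2)"
    using fin finite_same_card_bij[of "UNIV :: 'v set" "B1 \<union> B2"] by auto
  \<comment> \<open>\<open>Q\<close> is the change of basis with the basis vectors as columns;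
    \<open>E\<close> marks those that lie in the image.\<close>
  define Q :: "complex^'v^'v" where "Q = (\<chi> i j. f j $ i)"
  define E :: "complex^'v^'v" where "E = (\<chi> i j. if i = j \<and> f j \<in> B1 then 1 else 0)"
  have Qcol: "column j Q = f j" for j by (simp add: Q_def column_def vec_eq_iff)
  have AQ: "A ** Q = Q ** E"
  proof -
    have "(A ** Q) $ i $ j = (Q ** E) $ i $ j" for i j
    proof -
      have "(A ** Q) $ i $ j = (A *v f j) $ i"
        by (simp add: matrix_matrix_mult_def matrix_vector_mult_def Q_def)
      also have "A *v f j = (if f j \<in> B1 then f j else 0)"
      proof (cases "f j \<in> B1")
        case True
        then have "A *v f j = f j" using B1(1) fixR by blast
        with True show ?thesis by simp
      next
        case False
        then have "f j \<in> B2" using f by (auto simp: bij_betw_def)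
        with False B2(1) show ?thesis by auto
      qed
      also have "\<dots> $ i = (\<Sum>k\<in>UNIV. if k = j then if f j \<in> B1 then f j $ i else 0 else 0)"
        by simp
      also have "\<dots> = (\<Sum>k\<in>UNIV. f k $ i * (if k = j \<and> f j \<in> B1 then 1 else 0))"
        by (rule sum.cong) auto
      also have "\<dots> = (Q ** E) $ i $ j"
        by (simp add: matrix_matrix_mult_def Q_def E_def)
      finally show ?thesis .
    qed
    then show ?thesis by (simp add: vec_eq_iff)
  qed
  have "\<exists>B. Q ** B = mat 1"
  proof -
    have "columns Q = B1 \<union> B2"
      using f Qcol by (auto simp: columns_def bij_betw_def)
    then show ?thesis using span by (simp add: matrix_right_invertible_span_columns)
  qed
  then obtain B where B: "Q ** B = mat 1" by blast
  then have B': "B ** Q = mat 1" by (simp add: matrix_left_right_inverse)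
  have "A = A ** (Q ** B)" by (simp add: B)
  also have "\<dots> = Q ** E ** B" by (simp add: matrix_mul_assoc AQ)
  finally have "trace A = trace (Q ** E ** B)" by simp
  also have "\<dots> = trace (B ** (Q ** E))" by (rule trace_mul_sym)
  also have "\<dots> = trace E" by (simp add: matrix_mul_assoc B')
  also have "\<dots> = (\<Sum>j\<in>UNIV. if f j \<in> B1 then 1 else 0)" by (simp add: trace_def E_def)
  also have "\<dots> = of_nat (card {j. f j \<in> B1})" by (simp add: sum.If_cases)
  also have "card {j. f j \<in> B1} = card B1"
    by (rule bij_betw_same_card[where f = f])
       (use f in \<open>auto simp: bij_betw_def intro: inj_on_subset\<close>)
  finally show ?thesis using B1(4) by simp
qed

section \<open>Weight projectors and their functional calculus\<close>

lemma sum_mset_sum: "(\<Sum>\<mu>\<in>#(\<Sum>x\<in>W. M x). f \<mu>) = (\<Sum>x\<in>W. \<Sum>\<mu>\<in>#M x. f \<mu>)"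
  by (induction W rule: infinite_finite_induct) auto

lemma characters_eqI:
  "\<xi> \<in> characters T \<Longrightarrow> \<eta> \<in> characters T \<Longrightarrow> (\<And>t. t \<in> T \<Longrightarrow> \<xi> t = \<eta> t) \<Longrightarrow> \<xi> = \<eta>"
  unfolding characters_def by (auto intro: extensionalityI)

locale spectral =
  fixes T :: "(complex^'N^'N) set" and \<sigma> :: "complex^'N^'N \<Rightarrow> complex^'v^'v" and C A
  assumes T: "algebraic_group T" and dec: "spectral_decomposition T \<sigma> C A"
begin

lemma fin: "finite C" and char: "\<xi> \<in> C \<Longrightarrow> \<xi> \<in> characters T" and nz: "\<xi> \<in> C \<Longrightarrow> A \<xi> \<noteq> 0"
  and orth: "\<xi> \<in> C \<Longrightarrow> \<eta> \<in> C \<Longrightarrow> A \<xi> ** A \<eta> = (if \<xi> = \<eta> then A \<xi> else 0)"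
  and one: "(\<Sum>\<xi>\<in>C. A \<xi>) = mat 1" and eq: "t \<in> T \<Longrightarrow> \<sigma> t = (\<Sum>\<xi>\<in>C. cscale (\<xi> t) (A \<xi>))"
  using dec unfolding spectral_decomposition_def by blast+

lemma A_calculus: "A \<xi> ** (\<Sum>\<eta>\<in>C. cscale (y \<eta>) (A \<eta>)) = cscale (y \<xi>) (A \<xi>)" if \<xi>: "\<xi> \<in> C"
proof -
  have "A \<xi> ** (\<Sum>\<eta>\<in>C. cscale (y \<eta>) (A \<eta>)) = (\<Sum>\<eta>\<in>C. cscale (y \<eta>) (A \<xi> ** A \<eta>))"
    by (simp add: matrix_sum_right)
  also have "\<dots> = (\<Sum>\<eta>\<in>C. if \<xi> = \<eta> then cscale (y \<xi>) (A \<xi>) else 0)"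
    using \<xi> by (intro sum.cong) (auto simp: orth)
  finally show ?thesis using fin \<xi> by simp
qed

lemma calculus_A: "(\<Sum>\<eta>\<in>C. cscale (y \<eta>) (A \<eta>)) ** A \<xi> = cscale (y \<xi>) (A \<xi>)" if \<xi>: "\<xi> \<in> C"
proof -
  have "(\<Sum>\<eta>\<in>C. cscale (y \<eta>) (A \<eta>)) ** A \<xi> = (\<Sum>\<eta>\<in>C. cscale (y \<eta>) (A \<eta> ** A \<xi>))"
    by (simp add: matrix_sum_left)
  also have "\<dots> = (\<Sum>\<eta>\<in>C. if \<xi> = \<eta> then cscale (y \<xi>) (A \<xi>) else 0)"
    using \<xi> by (intro sum.cong) (auto simp: orth)
  finally show ?thesis using fin \<xi> by simp
qed

text \<open>Orthogonality of the projectors kills the mixed terms. Traces of products of such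
  combinations thus become sums over weights.\<close>

lemma calculus_mult:
  "(\<Sum>\<xi>\<in>C. cscale (x \<xi>) (A \<xi>)) ** (\<Sum>\<xi>\<in>C. cscale (y \<xi>) (A \<xi>)) = (\<Sum>\<xi>\<in>C. cscale (x \<xi> * y \<xi>) (A \<xi>))"
  unfolding matrix_sum_left by (intro sum.cong refl) (simp add: A_calculus)

text \<open>A vector of weight \<open>\<mu>\<close> is killed by \<open>A \<eta>\<close> for every
  other \<open>\<eta>\<close> in \<open>C\<close>: at a point separating the two characters, its
  component would be scaled by two different numbers at once. Since the projectors sum to the
  identity, weight spaces are their images and no further weights exist.\<close>

lemma weight_space_eq: "\<xi> \<in> C \<Longrightarrow> weight_space T \<sigma> \<xi> = range ((*v) (A \<xi>))"
  and weights_eq: "weights T \<sigma> = C"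
proof -
  have kill: "A \<eta> *v v = 0" if "\<eta> \<in> C" "\<mu> \<in> characters T" "\<eta> \<noteq> \<mu>" "v \<in> weight_space T \<sigma> \<mu>" for \<eta> \<mu> v
  proof -
    from that char characters_eqI obtain t where t: "t \<in> T" "\<eta> t \<noteq> \<mu> t" by blast
    have "\<mu> t *s (A \<eta> *v v) = A \<eta> *v (\<sigma> t *v v)"
      using that(4) t by (simp add: weight_space_def vec.linear_scale[OF matrix_vector_mul_linear_gen])
    also have "\<dots> = \<eta> t *s (A \<eta> *v v)"
      by (simp add: matrix_vector_mul_assoc eq[OF t(1)] A_calculus[OF that(1)] cscale_vec)
    finally have "(\<mu> t - \<eta> t) *s (A \<eta> *v v) = 0" by (simp add: vec.scale_left_diff_distrib)
    then show ?thesis using t(2) by simp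
  qed
  have expand: "v = (\<Sum>\<eta>\<in>C. A \<eta> *v v)" for v
    using one by (metis matrix_vector_mul_lid sum_matrix_vec)
  show ws: "weight_space T \<sigma> \<xi> = range ((*v) (A \<xi>))" if \<xi>: "\<xi> \<in> C" for \<xi>
  proof (intro equalityI subsetI)
    fix v assume v: "v \<in> weight_space T \<sigma> \<xi>"
    have "v = (\<Sum>\<eta>\<in>C. A \<eta> *v v)" by (rule expand)
    also have "\<dots> = A \<xi> *v v"
      using fin \<xi> kill[OF _ char[OF \<xi>] _ v] by (subst sum.remove[of _ \<xi>]) auto
    finally show "v \<in> range ((*v) (A \<xi>))" by blast
  next
    fix v assume "v \<in> range ((*v) (A \<xi>))"
    then show "v \<in> weight_space T \<sigma> \<xi>"
      using \<xi> by (auto simp: weight_space_def matrix_vector_mul_assoc eq calculus_A cscale_vec)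
  qed
  show "weights T \<sigma> = C"
  proof (intro equalityI subsetI)
    fix \<mu> assume "\<mu> \<in> weights T \<sigma>"
    then have \<mu>: "\<mu> \<in> characters T" "weight_space T \<sigma> \<mu> \<noteq> {0}" by (auto simp: weights_def)
    have "0 \<in> weight_space T \<sigma> \<mu>" by (simp add: weight_space_def)
    with \<mu> obtain v where v: "v \<in> weight_space T \<sigma> \<mu>" "v \<noteq> 0" by blast
    show "\<mu> \<in> C"
    proof (rule ccontr)
      assume "\<mu> \<notin> C"
      then have "(\<Sum>\<eta>\<in>C. A \<eta> *v v) = 0" using kill[OF _ \<mu>(1) _ v(1)] by (intro sum.neutral) auto
      with expand[of v] v show False by simp
    qed
  next
    fix \<mu> assume \<mu>: "\<mu> \<in> C"
    have "\<exists>v. A \<mu> *v v \<noteq> 0"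
      using nz[OF \<mu>] by (metis matrix_eq matrix_vector_mult_0)
    then show "\<mu> \<in> weights T \<sigma>"
      using char[OF \<mu>] ws[OF \<mu>] by (auto simp: weights_def)
  qed
qed

lemma trace_A: "\<xi> \<in> C \<Longrightarrow> trace (A \<xi>) = of_nat (vec.dim (weight_space T \<sigma> \<xi>))"
  by (simp add: weight_space_eq idempotent_trace orth)

lemma dim_pos: "\<xi> \<in> C \<Longrightarrow> vec.dim (weight_space T \<sigma> \<xi>) > 0"
proof (rule ccontr)
  assume \<xi>: "\<xi> \<in> C" and "\<not> vec.dim (weight_space T \<sigma> \<xi>) > 0"
  then have "range ((*v) (A \<xi>)) \<subseteq> {0}" by (simp add: weight_space_eq vec.dim_eq_0)
  then have "A \<xi> = 0" by (auto simp: matrix_eq)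
  with nz[OF \<xi>] show False by simp
qed

text \<open>\<open>trace (A \<xi>)\<close> stands for the multiplicity of \<open>\<xi>\<close>,
  which lets sums over the weight multiset be matched with traces.\<close>

lemma sum_weight_mset: "(\<Sum>\<mu>\<in>#weight_mset T \<sigma>. f \<mu>) = (\<Sum>\<xi>\<in>C. trace (A \<xi>) * f \<xi>)"
  by (simp add: weight_mset_def sum_mset_sum weights_eq trace_A cong: sum.cong)

lemma trace_calculus: "trace (\<Sum>\<xi>\<in>C. cscale (x \<xi>) (A \<xi>)) = (\<Sum>\<xi>\<in>C. trace (A \<xi>) * x \<xi>)"
  by (simp add: trace_sum trace_cscale mult.commute)

lemma char_regular: "\<xi> \<in> C \<Longrightarrow> regular_on T \<xi>"
  using char by (auto simp: characters_def)

text \<open>Termwise differentiation of the decomposition of \<open>\<sigma>\<close>; the projectors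
  are constant, so only the characters contribute.\<close>

lemma rep_differential_eq:
  assumes X: "X \<in> lie_algebra T"
  shows "rep_differential T \<sigma> X = (\<Sum>\<xi>\<in>C. cscale (differential T \<xi> X) (A \<xi>))"
proof -
  have "differential T (\<lambda>t. \<sigma> t $ a $ b) X = (\<Sum>\<xi>\<in>C. differential T \<xi> X * A \<xi> $ a $ b)" for a b
  proof -
    have "differential T (\<lambda>t. \<sigma> t $ a $ b) X = differential T (\<lambda>t. \<Sum>\<xi>\<in>C. A \<xi> $ a $ b * \<xi> t) X"
      by (rule differential_cong) (simp add: eq mult.commute)
    also have "\<dots> = (\<Sum>\<xi>\<in>C. A \<xi> $ a $ b * differential T \<xi> X)"
      by (subst differential_sum[OF T X])
         (auto simp: differential_cmult[OF T X char_regular]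
           intro: regular_on_mult regular_on_const char_regular)
    finally show ?thesis by (simp add: mult.commute)
  qed
  then show ?thesis by (simp add: rep_differential_def vec_eq_iff)
qed

text \<open>Each \<open>trace (A \<xi>)\<close> is the dimension of a nonzero weight space, so the
  sum is one of squared norms with positive coefficients.\<close>

lemma definite:
  assumes "(\<Sum>\<xi>\<in>C. trace (A \<xi>) * (z \<xi> * cnj (z \<xi>))) = 0" "\<xi> \<in> C"
  shows "z \<xi> = 0"
proof -
  let ?d = "\<lambda>\<xi>. real (vec.dim (weight_space T \<sigma> \<xi>)) * (norm (z \<xi>))\<^sup>2"
  have "(\<Sum>\<xi>\<in>C. trace (A \<xi>) * (z \<xi> * cnj (z \<xi>))) = complex_of_real (\<Sum>\<xi>\<in>C. ?d \<xi>)"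
    by (simp add: trace_A complex_mult_cnj cmod_def)
  then have "complex_of_real (\<Sum>\<xi>\<in>C. ?d \<xi>) = 0" using assms(1) by simp
  then have "(\<Sum>\<xi>\<in>C. ?d \<xi>) = 0" by (simp only: of_real_eq_0_iff)
  then have "?d \<xi> = 0" using fin assms(2) by (subst (asm) sum_nonneg_eq_0_iff) auto
  moreover have "real (vec.dim (weight_space T \<sigma> \<xi>)) \<noteq> 0"
    using dim_pos[OF assms(2)] by (simp only: of_nat_eq_0_iff)
  ultimately show ?thesis by (simp only: mult_eq_0_iff) simp
qed

text \<open>A nonzero vector has some nonzero component \<open>A \<xi> *v v\<close>, and that
  component identifies \<open>c\<close>. The lemma bounds the eigenvalues of a coroot on C^N by a
  finite set.\<close>

lemma eigenvalue:
  assumes X: "X \<in> lie_algebra T" and "rep_differential T \<sigma> X *v v = c *s v" "v \<noteq> 0"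
  shows "\<exists>\<xi>\<in>C. c = differential T \<xi> X"
proof (rule ccontr)
  assume ne: "\<not> ?thesis"
  have "A \<xi> *v v = 0" if \<xi>: "\<xi> \<in> C" for \<xi>
  proof -
    have "c *s (A \<xi> *v v) = A \<xi> *v (rep_differential T \<sigma> X *v v)"
      by (simp add: assms(2) vec.linear_scale[OF matrix_vector_mul_linear_gen])
    also have "\<dots> = differential T \<xi> X *s (A \<xi> *v v)"
      by (simp add: rep_differential_eq[OF X] matrix_vector_mul_assoc A_calculus[OF \<xi>] cscale_vec)
    finally have "(c - differential T \<xi> X) *s (A \<xi> *v v) = 0"
      by (simp add: vec.scale_left_diff_distrib)
    with ne \<xi> show ?thesis by auto
  qed
  then have "(\<Sum>\<xi>\<in>C. A \<xi>) *v v = 0" by (simp add: sum_matrix_vec)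
  with assms(3) show False by (simp add: one)
qed

lemma eigenvector:
  assumes "\<xi> \<in> C" and X: "X \<in> lie_algebra T"
  shows "\<exists>v. v \<noteq> 0 \<and> rep_differential T \<sigma> X *v v = differential T \<xi> X *s v"
proof -
  obtain v where "A \<xi> *v v \<noteq> 0" using nz[OF assms(1)] by (metis matrix_eq matrix_vector_mult_0)
  then show ?thesis
    by (intro exI[of _ "A \<xi> *v v"])
       (simp add: rep_differential_eq[OF X] matrix_vector_mul_assoc calculus_A[OF assms(1)] cscale_vec)
qed

end

section \<open>The tautological representation and brackets with root vectors\<close>

lemma rep_differential_id:
  "algebraic_group T \<Longrightarrow> X \<in> lie_algebra T \<Longrightarrow> rep_differential T (\<lambda>t. t) X = X"
  by (simp add: rep_differential_def differential_entry vec_eq_iff)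

lemma alg_hom_id: "algebraic_group T \<Longrightarrow> alg_hom T GL (\<lambda>t. t)"
  using algebraic_group_GL by (auto simp: alg_hom_def regular_on_entry)

text \<open>Differentiates the relation \<open>eq\<close> at the identity, entry by entry. A scalar
  function on each side allows roots and their inverses to be treated alike.\<close>

lemma differential_conjugation:
  assumes T: "algebraic_group T" "X \<in> lie_algebra T"
    and u: "regular_on T u" "u (mat 1) = 1" and w: "regular_on T w" "w (mat 1) = 1"
    and eq: "\<And>t. t \<in> T \<Longrightarrow> cscale (u t) (t ** e) = cscale (w t) (e ** t)"
  shows "X ** e - e ** X = cscale (differential T w X - differential T u X) e"
proof -
  have entry: "(cscale (differential T u X) e + X ** e) $ a $ b = (cscale (differential T w X) e + e ** X) $ a $ b"
    for a b
  proof -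
    have rl: "regular_on T (\<lambda>t. \<Sum>k\<in>UNIV. e $ k $ b * t $ a $ k)"
      and rr: "regular_on T (\<lambda>t. \<Sum>k\<in>UNIV. e $ a $ k * t $ k $ b)"
      by (intro regular_on_sum regular_on_mult regular_on_const regular_on_entry)+
    have "differential T (\<lambda>t. u t * (\<Sum>k\<in>UNIV. e $ k $ b * t $ a $ k)) X =
        differential T (\<lambda>t. w t * (\<Sum>k\<in>UNIV. e $ a $ k * t $ k $ b)) X"
    proof (rule differential_cong)
      fix t assume "t \<in> T"
      from eq[OF this] have "cscale (u t) (t ** e) $ a $ b = cscale (w t) (e ** t) $ a $ b" by simp
      then show "u t * (\<Sum>k\<in>UNIV. e $ k $ b * t $ a $ k) = w t * (\<Sum>k\<in>UNIV. e $ a $ k * t $ k $ b)"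
        by (simp add: matrix_matrix_mult_def mult.commute)
    qed
    moreover have "(\<Sum>k\<in>UNIV. e $ k $ b * (mat 1 :: complex^'a^'a) $ a $ k) = (mat 1 ** e) $ a $ b"
      unfolding matrix_matrix_mult_def by (simp add: mult.commute)
    moreover have "(\<Sum>k\<in>UNIV. e $ a $ k * (mat 1 :: complex^'a^'a) $ k $ b) = (e ** mat 1) $ a $ b"
      unfolding matrix_matrix_mult_def by simp
    moreover
    have "differential T (\<lambda>t. \<Sum>k\<in>UNIV. c k * t $ p k $ q k) X = (\<Sum>k\<in>UNIV. c k * X $ p k $ q k)"
      for c and p q :: "'a \<Rightarrow> 'a"
      by (subst differential_sum[OF T])
         (auto simp: differential_cmult[OF T regular_on_entry] differential_entry[OF T]
           intro: regular_on_mult regular_on_const regular_on_entry)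
    note d = this
    have "differential T (\<lambda>t. \<Sum>k\<in>UNIV. e $ k $ b * t $ a $ k) X = (X ** e) $ a $ b"
      "differential T (\<lambda>t. \<Sum>k\<in>UNIV. e $ a $ k * t $ k $ b) X = (e ** X) $ a $ b"
      unfolding d matrix_matrix_mult_def by (simp_all add: mult.commute)
    ultimately show ?thesis
      by (simp add: differential_mult[OF T u(1) rl] differential_mult[OF T w(1) rr] u w)
  qed
  have "(X ** e - e ** X) $ a $ b = cscale (differential T w X - differential T u X) e $ a $ b" for a b
  proof -
    have "p - q = v - u" if "u + p = v + q" for u v p q :: complex
      using that by (simp add: algebra_simps)
    from this[of "differential T u X * e $ a $ b" "(X ** e) $ a $ b" "differential T w X * e $ a $ b" "(e ** X) $ a $ b"]
    show ?thesis using entry[of a b] by (simp add: left_diff_distrib)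
  qed
  then show ?thesis unfolding vec_eq_iff by blast
qed

lemma root_space_commute:
  assumes T: "algebraic_group T" "t \<in> T" and e: "e \<in> root_space G T \<xi>"
  shows "t ** e = cscale (\<xi> t) (e ** t)"
proof -
  have "invertible t" using algebraic_group_GL[OF T(1)] T(2) by blast
  then have "\<exists>A'. t ** A' = mat 1 \<and> A' ** t = mat 1" by (simp add: invertible_def)
  then have "matrix_inv t ** t = mat 1"
    unfolding matrix_inv_def by (rule someI2_ex) simp
  then have "t ** e = (t ** e ** matrix_inv t) ** t"
    by (simp add: matrix_mul_assoc[symmetric])
  also have "\<dots> = cscale (\<xi> t) (e ** t)" using e T by (simp add: root_space_def)
  finally show ?thesis .
qed

lemma character_one:
  assumes "algebraic_group T" "\<xi> \<in> characters T"
  shows "\<xi> (mat 1) = 1"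
proof -
  have 1: "mat 1 \<in> T" using assms(1) by (simp add: algebraic_group_def)
  with assms(2) have "\<xi> (mat 1 ** mat 1) = \<xi> (mat 1) * \<xi> (mat 1)" "\<xi> (mat 1) \<noteq> 0"
    unfolding characters_def by blast+
  then show ?thesis by simp
qed

lemma root_space_bracket:
  assumes T: "algebraic_group T" "X \<in> lie_algebra T" and \<xi>: "\<xi> \<in> characters T"
    and e: "e \<in> root_space G T \<xi>"
  shows "X ** e - e ** X = cscale (differential T \<xi> X) e"
  using differential_conjugation[OF T regular_on_const[of _ 1] refl, of \<xi> e] \<xi>
    root_space_commute[OF T(1) _ e] character_one[OF T(1) \<xi>]
  by (simp add: differential_const[OF T] characters_def)

text \<open>The inverse of the character is cleared by multiplying with \<open>\<xi> t\<close>, so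
  only \<open>\<xi>\<close> itself is differentiated.\<close>

lemma opposite_root_space_bracket:
  assumes T: "algebraic_group T" "X \<in> lie_algebra T" and \<xi>: "\<xi> \<in> characters T"
    and f: "f \<in> root_space G T (\<lambda>t. inverse (\<xi> t))"
  shows "X ** f - f ** X = cscale (- differential T \<xi> X) f"
proof -
  have "cscale (\<xi> t) (t ** f) = cscale 1 (f ** t)" if "t \<in> T" for t
    using root_space_commute[OF T(1) that f] \<xi> that by (simp add: characters_def)
  from differential_conjugation[OF T _ _ regular_on_const[of _ 1] refl this] show ?thesis
    using \<xi> character_one[OF T(1) \<xi>] by (simp add: differential_const[OF T] characters_def)
qed

subsection \<open>Coroots\<close>

text \<open>\<open>x\<close> shifts eigenvalues of \<open>h\<close> by \<open>a\<close>. Infinitely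
  many nonzero powers would give infinitely many eigenvalues, so the chain stops. It serves for the
  raising operator with \<open>a = 2\<close> and the lowering operator with
  \<open>a = -2\<close>.\<close>

lemma eigenvector_chain:
  fixes h x :: "complex^'n^'n"
  assumes comm: "h ** x - x ** h = cscale a x" and "a \<noteq> 0"
    and fin: "finite {c. \<exists>v. v \<noteq> 0 \<and> h *v v = c *s v}"
    and v: "v \<noteq> 0" "h *v v = c *s v"
  shows "h *v (((*v) x ^^ k) v) = (c + of_nat k * a) *s (((*v) x ^^ k) v)"
    and "\<exists>k. ((*v) x ^^ k) v \<noteq> 0 \<and> x *v (((*v) x ^^ k) v) = 0"
proof -
  have hx: "h *v (x *v w) = x *v (h *v w) + a *s (x *v w)" for w
  proof -
    have "h ** x = x ** h + cscale a x" using comm by (simp add: algebra_simps)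
    then show ?thesis
      by (simp add: matrix_vector_mul_assoc matrix_vector_mult_add_rdistrib cscale_vec)
  qed
  show eig: "h *v (((*v) x ^^ k) v) = (c + of_nat k * a) *s (((*v) x ^^ k) v)" for k
  proof (induction k)
    case 0
    then show ?case by (simp add: v)
  next
    case (Suc k)
    show ?case
      by (simp add: hx Suc.IH vec.linear_scale[OF matrix_vector_mul_linear_gen] vec.scale_left_distrib algebra_simps)
  qed
  have "\<exists>k. ((*v) x ^^ k) v = 0"
  proof (rule ccontr)
    assume "\<not> ?thesis"
    then have "range (\<lambda>k. c + of_nat k * a) \<subseteq> {c. \<exists>v. v \<noteq> 0 \<and> h *v v = c *s v}"
      using eig by auto
    then have "finite (range (\<lambda>k. c + of_nat k * a))" using fin finite_subset by blast
    moreover have "inj (\<lambda>k. c + of_nat k * a)" using \<open>a \<noteq> 0\<close> by (auto intro: injI)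
    ultimately show False using finite_imageD infinite_UNIV_nat by blast
  qed
  then obtain k where k: "((*v) x ^^ k) v = 0" "\<And>j. j < k \<Longrightarrow> ((*v) x ^^ j) v \<noteq> 0"
    using exists_least_iff[of "\<lambda>k. ((*v) x ^^ k) v = 0"] by blast
  \<comment> \<open>\<open>k\<close> is the first vanishing power, and it is positive because
    \<open>v\<close> is nonzero; its predecessor ends the chain.\<close>
  then obtain j where "k = Suc j" using v by (cases k) auto
  with k show "\<exists>k. ((*v) x ^^ k) v \<noteq> 0 \<and> x *v (((*v) x ^^ k) v) = 0"
    by (intro exI[of _ j]) auto
qed

text \<open>Raising \<open>v\<close> as far as possible gives a vector \<open>w\<close> killed by
  \<open>e\<close>, of eigenvalue \<open>l = c + 2k\<close>. On the lowering chain from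
  \<open>w\<close>, \<open>ew\<close> gives \<open>e f\<close> the eigenvalue (j + 1)(l - j); at the
  last nonzero vector this must vanish, so \<open>l\<close> is a natural number.\<close>

lemma sl2_eigenvalue_int:
  fixes h e f :: "complex^'n^'n"
  assumes h: "h = e ** f - f ** e"
    and he: "h ** e - e ** h = cscale 2 e" and hf: "h ** f - f ** h = cscale (- 2) f"
    and fin: "finite {c. \<exists>v. v \<noteq> 0 \<and> h *v v = c *s v}"
    and v: "v \<noteq> 0" "h *v v = c *s v"
  shows "c \<in> \<int>"
proof -
  obtain k where k: "((*v) e ^^ k) v \<noteq> 0" "e *v (((*v) e ^^ k) v) = 0"
    using eigenvector_chain(2)[OF he _ fin v] by auto
  define w where "w = ((*v) e ^^ k) v"
  define l where "l = c + of_nat k * 2"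
  have w: "w \<noteq> 0" "e *v w = 0" "h *v w = l *s w"
    using k eigenvector_chain(1)[OF he _ fin v, of k] by (simp_all add: w_def l_def)
  let ?w = "\<lambda>j. ((*v) f ^^ j) w"
  have hw: "h *v ?w j = (l + of_nat j * (- 2)) *s ?w j" for j
    using eigenvector_chain(1)[OF hf _ fin w(1,3), of j] by simp
  have ef: "e *v (f *v u) = f *v (e *v u) + h *v u" for u
    by (simp add: h matrix_vector_mul_assoc matrix_vector_mult_diff_rdistrib)
  have ew: "e *v (f *v ?w j) = ((of_nat j + 1) * (l - of_nat j)) *s ?w j" for j
  proof (induction j)
    case 0
    show ?case using ef[of w] w by simp
  next
    case (Suc j)
    have "e *v (f *v ?w (Suc j)) = f *v (e *v (f *v ?w j)) + h *v ?w (Suc j)"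
      using ef[of "?w (Suc j)"] by simp
    also have "\<dots> = ((of_nat j + 1) * (l - of_nat j)) *s ?w (Suc j) + (l + of_nat (Suc j) * (- 2)) *s ?w (Suc j)"
      by (subst hw) (simp add: Suc.IH vec.linear_scale[OF matrix_vector_mul_linear_gen])
    also have "\<dots> = ((of_nat (Suc j) + 1) * (l - of_nat (Suc j))) *s ?w (Suc j)"
      by (simp only: vec.scale_left_distrib[symmetric]) (simp add: algebra_simps)
    finally show ?case .
  qed
  obtain j where j: "?w j \<noteq> 0" "f *v ?w j = 0"
    using eigenvector_chain(2)[OF hf _ fin w(1,3)] by auto
  with ew[of j] have "(of_nat j + 1) * (l - of_nat j) = 0" by simp
  moreover have "(of_nat j + 1 :: complex) \<noteq> 0" by (metis of_nat_Suc of_nat_neq_0 add.commute)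
  ultimately have "l - of_nat j = 0" by (simp only: mult_eq_0_iff simp_thms)
  then have "c = of_nat j - of_nat k * 2" by (simp add: l_def algebra_simps)
  then show ?thesis by simp
qed

lemma coroot_differential_real:
  assumes chart: "torus_chart T I \<phi> \<psi>" and \<alpha>: "\<alpha> \<in> characters T" and h: "is_coroot G T \<alpha> h"
    and \<xi>: "\<xi> \<in> characters T"
  shows "differential T \<xi> h \<in> \<real>"
proof -
  interpret torus_chart T I \<phi> \<psi> by (rule chart)
  obtain C A where "spectral_decomposition T (\<lambda>t. t) C A"
    using alg_hom_decomposition[OF alg_hom_id[OF T]] by blast
  then interpret spectral T "\<lambda>t. t" C A by unfold_locales (use T in auto)
  obtain e f where ef: "e \<in> root_space G T \<alpha>" "f \<in> root_space G T (\<lambda>t. inverse (\<alpha> t))"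
    "h = e ** f - f ** e" and hT: "h \<in> lie_algebra T" and two: "differential T \<alpha> h = 2"
    using h unfolding is_coroot_def bracket_def by blast
  have he: "h ** e - e ** h = cscale 2 e" "h ** f - f ** h = cscale (- 2) f"
    using root_space_bracket[OF T hT \<alpha> ef(1)] opposite_root_space_bracket[OF T hT \<alpha> ef(2)]
    by (simp_all add: two)
  \<comment> \<open>Every eigenvalue of \<open>h\<close> on C^N is a weight differential; hence the
    finiteness that the chain argument needs.\<close>
  have "{c. \<exists>v. v \<noteq> 0 \<and> h *v v = c *s v} \<subseteq> (\<lambda>\<xi>. differential T \<xi> h) ` C"
    using eigenvalue[OF hT] by (auto simp: rep_differential_id[OF T hT])
  then have fin': "finite {c. \<exists>v. v \<noteq> 0 \<and> h *v v = c *s v}"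
    using fin finite_subset by blast
  have int: "differential T \<eta> h \<in> \<int>" if "\<eta> \<in> C" for \<eta>
    using eigenvector[OF that hT] sl2_eigenvalue_int[OF ef(3) he fin']
    by (auto simp: rep_differential_id[OF T hT])
  \<comment> \<open>For this \<open>L\<close>, \<open>exponential\<close> yields \<open>t\<close> on
    which each character takes the exponential of the imaginary part of its differential at
    \<open>h\<close>. The weights of C^N are integral at \<open>h\<close>, so they are 1 at
    \<open>t\<close>, and \<open>t\<close> is the identity.\<close>
  have "linear (\<lambda>z. complex_of_real (Im z))"
    by (intro linearI) (auto simp: scaleR_conv_of_real)
  from exponential[OF hT this] obtain t where
    t: "t \<in> T" "\<And>\<eta>. \<eta> \<in> characters T \<Longrightarrow> \<eta> t = exp (complex_of_real (Im (differential T \<eta> h)))"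
    by blast
  have "\<eta> t = 1" if "\<eta> \<in> C" for \<eta>
    using t(2)[OF char[OF that]] int[OF that] by (auto elim!: Ints_cases)
  then have "(\<Sum>\<xi>\<in>C. cscale (\<xi> t) (A \<xi>)) = (\<Sum>\<xi>\<in>C. cscale 1 (A \<xi>))"
    by (intro sum.cong refl arg_cong2[where f = cscale])
  also have "\<dots> = mat 1" by (simp add: one)
  finally have "(\<Sum>\<xi>\<in>C. cscale (\<xi> t) (A \<xi>)) = mat 1" .
  then have "t = mat 1" using eq[OF t(1)] by (rule trans[rotated])
  then have "exp (complex_of_real (Im (differential T \<xi> h))) = 1"
    using t(2)[OF \<xi>] character_one[OF T \<xi>] by simp
  then have "exp (Im (differential T \<xi> h)) = 1"
    by (metis exp_of_real of_real_eq_1_iff)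
  then show ?thesis by (simp add: complex_is_Real_iff)
qed

text \<open>A character with nonzero differential at \<open>X\<close> would separate infinitely many
  elements along \<open>X\<close>, all in the finite kernel. So every character differential
  vanishes at \<open>X\<close>, in particular those of the weights of C^N, which recover
  \<open>X\<close>.\<close>

lemma finite_kernel_differential:
  assumes chart: "torus_chart T I \<phi> \<psi>" and \<rho>: "spectral_decomposition T \<rho> C A"
    and ker: "finite {t \<in> T. \<rho> t = mat 1}"
    and X: "X \<in> lie_algebra T" and X0: "\<And>\<xi>. \<xi> \<in> C \<Longrightarrow> differential T \<xi> X = 0"
  shows "X = 0"
proof -
  interpret torus_chart T I \<phi> \<psi> by (rule chart)
  interpret \<rho>: spectral T \<rho> C A by unfold_locales (use T \<rho> in auto)
  have all0: "differential T \<eta> X = 0" if \<eta>: "\<eta> \<in> characters T" for \<eta>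
  proof (rule ccontr)
    define w where "w = differential T \<eta> X"
    assume "differential T \<eta> X \<noteq> 0"
    then have w: "w \<noteq> 0" by (simp add: w_def)
    \<comment> \<open>The factor \<open>r / w\<close> gives \<open>\<eta>\<close> the value exp(r),
      which is injective in real \<open>r\<close>; the weights in \<open>C\<close> stay 1 because
      their differentials vanish at \<open>X\<close>.\<close>
    have "\<exists>t\<in>T. \<forall>\<xi>\<in>characters T. \<xi> t = exp (of_real r / w * differential T \<xi> X)" for r :: real
      by (rule exponential[OF X]) (intro linearI, simp_all add: algebra_simps add_divide_distrib scaleR_conv_of_real)
    then obtain g where g: "\<And>r. g r \<in> T"
      "\<And>r \<xi>. \<xi> \<in> characters T \<Longrightarrow> \<xi> (g r) = exp (complex_of_real r / w * differential T \<xi> X)"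
      by metis
    have "\<rho> (g r) = mat 1" for r
      using \<rho>.eq[OF g(1)] \<rho>.one by (simp add: g(2) \<rho>.char X0)
    then have "range g \<subseteq> {t \<in> T. \<rho> t = mat 1}" using g(1) by blast
    then have "finite (range g)" using ker finite_subset by blast
    moreover have "inj g"
    proof (rule injI)
      fix r s assume "g r = g s"
      then have "exp (complex_of_real r) = exp (complex_of_real s)"
        using g(2)[OF \<eta>, of r] g(2)[OF \<eta>, of s] w by (simp add: w_def)
      then show "r = s" by (metis exp_of_real of_real_eq_iff exp_inj_iff)
    qed
    ultimately show False using finite_imageD infinite_UNIV_char_0 by blast
  qed
  obtain C' A' where "spectral_decomposition T (\<lambda>t. t) C' A'"
    using alg_hom_decomposition[OF alg_hom_id[OF T]] by blast
  then interpret id: spectral T "\<lambda>t. t" C' A' by unfold_locales (use T in auto)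
  show "X = 0"
    using id.rep_differential_eq[OF X] by (simp add: rep_differential_id[OF T X] all0 id.char)
qed

lemma coroots_independent:
  fixes x :: "'n::finite \<Rightarrow> complex"
  assumes chart: "torus_chart T I \<phi> \<psi>" and \<alpha>: "simple_roots G T \<alpha>"
    and h: "\<And>i. is_coroot G T (\<alpha> i) (h i)"
    and x: "(\<Sum>i\<in>UNIV. cscale (x i) (h i)) = 0"
  shows "x i = 0"
proof -
  interpret torus_chart T I \<phi> \<psi> by (rule chart)
  obtain C A where "spectral_decomposition T (\<lambda>t. t) C A"
    using alg_hom_decomposition[OF alg_hom_id[OF T]] by blast
  then interpret spectral T "\<lambda>t. t" C A by unfold_locales (use T in auto)
  have char\<alpha>: "\<alpha> j \<in> characters T" for j
    using \<alpha> by (auto simp: simple_roots_def roots_def)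
  have hT: "h j \<in> lie_algebra T" and two: "differential T (\<alpha> j) (h j) = 2" for j
    using h[of j] by (auto simp: is_coroot_def)
  \<comment> \<open>The trace form on C^N turns each coroot into a nonzero multiple of its simple
    root, so a relation between coroots becomes one between simple roots.\<close>
  have "\<exists>a. a \<noteq> 0 \<and> (\<forall>Y\<in>lie_algebra T. trace (h j ** Y) = a * differential T (\<alpha> j) Y)" for j
  proof -
    obtain e f where ef: "e \<in> root_space G T (\<alpha> j)" "f \<in> root_space G T (\<lambda>t. inverse (\<alpha> j t))"
      "h j = e ** f - f ** e"
      using h[of j] unfolding is_coroot_def bracket_def by blast
    have tr: "trace (h j ** Y) = trace (e ** f) * differential T (\<alpha> j) Y" if Y: "Y \<in> lie_algebra T" for Y
    proof -
      \<comment> \<open>Moving \<open>Y\<close> past \<open>f\<close> makes the two halves of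
        \<open>trace (h j ** Y)\<close> cancel by cyclicity, up to the term with
        \<open>trace (e ** f)\<close>.\<close>
      have "f ** Y = Y ** f + cscale (differential T (\<alpha> j) Y) f"
        using opposite_root_space_bracket[OF T Y char\<alpha> ef(2)]
        by (simp add: vec_eq_iff algebra_simps)
      then have "trace (e ** (f ** Y)) = trace (e ** (Y ** f)) + differential T (\<alpha> j) Y * trace (e ** f)"
        by (simp add: matrix_add_ldistrib trace_add trace_cscale)
      moreover have "trace (f ** (e ** Y)) = trace ((e ** Y) ** f)" by (rule trace_mul_sym)
      moreover have "h j ** Y = e ** (f ** Y) - f ** (e ** Y)"
        by (simp add: ef(3) matrix_diff_left matrix_mul_assoc)
      ultimately show ?thesis by (simp add: trace_sub matrix_mul_assoc)
    qed
    \<comment> \<open>Otherwise \<open>trace (h j ** h j)\<close> is 0. The weights are real at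
      \<open>h j\<close>, so this trace is a definite sum of squares and \<open>h j\<close> would be
      0, against \<open>two\<close>.\<close>
    have "trace (e ** f) \<noteq> 0"
    proof
      assume "trace (e ** f) = 0"
      then have "trace (h j ** h j) = 0" using tr[OF hT] by simp
      moreover have hj: "h j = (\<Sum>\<xi>\<in>C. cscale (differential T \<xi> (h j)) (A \<xi>))"
        using rep_differential_eq[OF hT] by (simp add: rep_differential_id[OF T hT])
      have "trace (h j ** h j) = (\<Sum>\<xi>\<in>C. trace (A \<xi>) * (differential T \<xi> (h j) * differential T \<xi> (h j)))"
        by (subst (1 2) hj) (simp only: calculus_mult trace_calculus)
      moreover have "cnj (differential T \<xi> (h j)) = differential T \<xi> (h j)" if "\<xi> \<in> C" for \<xi>
        using coroot_differential_real[OF chart char\<alpha> h char[OF that]] by (simp add: Reals_cnj_iff)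
      ultimately have "(\<Sum>\<xi>\<in>C. trace (A \<xi>) * (differential T \<xi> (h j) * cnj (differential T \<xi> (h j)))) = 0"
        by simp
      then have "differential T \<xi> (h j) = 0" if "\<xi> \<in> C" for \<xi>
        using that by (rule definite)
      then have "(\<Sum>\<xi>\<in>C. cscale (differential T \<xi> (h j)) (A \<xi>)) = 0" by simp
      with hj have "h j = 0" by (rule trans)
      \<comment> \<open>The empty linear combination evaluates the linear form at 0.\<close>
      moreover have "differential T (\<alpha> j) 0 = 0"
        using differential_sum_right[OF T, of "\<alpha> j" "{}"] char\<alpha>[of j]
        by (simp add: characters_def)
      ultimately show False using two[of j] by simp
    qed
    with tr show ?thesis by blast
  qed
  then obtain a where a: "\<And>j. a j \<noteq> 0"
    "\<And>j Y. Y \<in> lie_algebra T \<Longrightarrow> trace (h j ** Y) = a j * differential T (\<alpha> j) Y"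
    by metis
  have "\<forall>Y\<in>lie_algebra T. (\<Sum>j\<in>UNIV. (x j * a j) * differential T (\<alpha> j) Y) = 0"
  proof
    fix Y assume Y: "Y \<in> lie_algebra T"
    have "trace ((\<Sum>j\<in>UNIV. cscale (x j) (h j)) ** Y) = (\<Sum>j\<in>UNIV. (x j * a j) * differential T (\<alpha> j) Y)"
      by (simp add: matrix_sum_left trace_sum trace_cscale a(2)[OF Y] mult.assoc)
    then show "(\<Sum>j\<in>UNIV. (x j * a j) * differential T (\<alpha> j) Y) = 0"
      by (simp add: x trace_def)
  qed
  moreover have "\<forall>b. (\<forall>Y\<in>lie_algebra T. (\<Sum>j\<in>UNIV. b j * differential T (\<alpha> j) Y) = 0) \<longrightarrow> (\<forall>j. b j = 0)"
    using \<alpha> unfolding simple_roots_def by blast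
  then have "(\<forall>Y\<in>lie_algebra T. (\<Sum>j\<in>UNIV. (x j * a j) * differential T (\<alpha> j) Y) = 0) \<longrightarrow> (\<forall>j. x j * a j = 0)"
    by (rule spec)
  ultimately have "x i * a i = 0" by blast
  with a(1) show ?thesis by simp
qed

subsection \<open>The linear system\<close>

theorem theorem1:
  fixes G T :: "(complex^'N^'N) set"
    and \<alpha> :: "'n::finite \<Rightarrow> complex^'N^'N \<Rightarrow> complex"
    and h :: "'n \<Rightarrow> complex^'N^'N"
    and \<rho> :: "complex^'N^'N \<Rightarrow> complex^'v^'v"
    and lam :: "complex^'N^'N \<Rightarrow> complex"
    and \<pi> :: "complex^'v^'v \<Rightarrow> complex^'v^'v"
  assumes "simple_algebraic_group G" and "simply_connected G"
    and "maximal_torus G T" and "torus_of_rank CARD('n) T"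
    and "simple_roots G T \<alpha>" and "\<And>i. is_coroot G T (\<alpha> i) (h i)"
    and "irreducible_rep G \<rho>" and "highest_weight G T \<alpha> \<rho> lam"
    and "finite {g \<in> G. \<rho> g = mat 1}"
    and "is_projection (rep_differential G \<rho> ` lie_algebra G)
           (trace_perp (rep_differential G \<rho> ` lie_algebra G)) \<pi>"
  shows "\<forall>t\<in>T. \<forall>c :: complex^'n.
           springer_morphism G \<rho> \<pi> t = (\<Sum>i\<in>UNIV. cscale (c$i) (h i)) \<longrightarrow>
           (\<forall>x :: complex^'n.
              (\<chi> i. \<Sum>\<mu>\<in>#weight_mset T \<rho>. weight_coord T h \<mu> i * \<mu> t) = S_matrix T h \<rho> *v x
              \<longleftrightarrow> x = c)"
proof (intro ballI allI impI)
  fix t c x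
  assume t: "t \<in> T" and \<theta>: "springer_morphism G \<rho> \<pi> t = (\<Sum>i\<in>UNIV. cscale (c$i) (h i))"
  have G: "algebraic_group G" and TG: "T \<subseteq> G"
    using assms(1,3) by (auto simp: simple_algebraic_group_def maximal_torus_def)
  obtain I \<phi> \<psi> where chart: "torus_chart T I \<phi> \<psi>"
    using assms(4) by (rule torus_of_rank_chart)
  then interpret torus_chart T I \<phi> \<psi> .
  have \<rho>G: "alg_hom G GL \<rho>" using assms(7) by (simp add: irreducible_rep_def)
  then have "alg_hom T GL \<rho>" using TG regular_on_subset unfolding alg_hom_def by blast
  then obtain C A where dec: "spectral_decomposition T \<rho> C A" using alg_hom_decomposition by blast
  then interpret spectral T \<rho> C A by unfold_locales (use T in auto)
  have hT: "h i \<in> lie_algebra T" for i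
    using assms(6)[of i] by (simp add: is_coroot_def)
  have char\<alpha>: "\<alpha> i \<in> characters T" for i
    using assms(5) by (auto simp: simple_roots_def roots_def)
  let ?d = "\<lambda>\<xi> i. differential T \<xi> (h i)"
  \<comment> \<open>The tangent vector of \<open>T\<close> with coroot coordinates \<open>y\<close>;
    by \<open>\<theta>\<close> the Springer morphism takes the value \<open>?X c\<close> at
    \<open>t\<close>.\<close>
  let ?X = "\<lambda>y :: complex^'n. \<Sum>i\<in>UNIV. cscale (y$i) (h i)"
  have XT: "?X y \<in> lie_algebra T" for y by (intro lie_algebra_sum hT)
  have dX: "differential T \<xi> (?X y) = (\<Sum>j\<in>UNIV. y$j * ?d \<xi> j)" if "\<xi> \<in> C" for \<xi> y
    by (intro differential_sum_right T char_regular that hT)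
  \<comment> \<open>The right side is the trace of the product of the operators of
    \<open>?X y\<close> and \<open>h i\<close>: the matrix is the Gram matrix of the trace form in
    the coroots.\<close>
  have S: "(S_matrix T h \<rho> *v y) $ i = (\<Sum>\<xi>\<in>C. trace (A \<xi>) * (differential T \<xi> (?X y) * ?d \<xi> i))" for y i
  proof -
    have "(S_matrix T h \<rho> *v y) $ i = (\<Sum>j\<in>UNIV. (\<Sum>\<xi>\<in>C. trace (A \<xi>) * (?d \<xi> i * ?d \<xi> j)) * y$j)"
      by (simp add: matrix_vector_mult_def S_matrix_def sum_weight_mset weight_coord_def)
    also have "\<dots> = (\<Sum>\<xi>\<in>C. \<Sum>j\<in>UNIV. trace (A \<xi>) * (?d \<xi> i * ?d \<xi> j) * y$j)"
      unfolding sum_distrib_right by (rule sum.swap)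
    also have "\<dots> = (\<Sum>\<xi>\<in>C. trace (A \<xi>) * (differential T \<xi> (?X y) * ?d \<xi> i))"
      by (intro sum.cong refl) (simp add: dX sum_distrib_left sum_distrib_right mult_ac)
    finally show ?thesis .
  qed
  have inj: "y = 0" if y: "S_matrix T h \<rho> *v y = 0" for y
  proof -
    \<comment> \<open>The Hermitian pairing of \<open>S_matrix T h \<rho> *v y\<close> with
      \<open>y\<close>. Since the values \<open>?d \<xi> i\<close> are real, conjugating the
      differential conjugates only the coordinates of \<open>y\<close>.\<close>
    have "(\<Sum>\<xi>\<in>C. trace (A \<xi>) * (differential T \<xi> (?X y) * cnj (differential T \<xi> (?X y))))
       = (\<Sum>\<xi>\<in>C. \<Sum>i\<in>UNIV. trace (A \<xi>) * (differential T \<xi> (?X y) * ?d \<xi> i) * cnj (y$i))"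
    proof (intro sum.cong refl)
      fix \<xi> assume \<xi>: "\<xi> \<in> C"
      have "cnj (?d \<xi> i) = ?d \<xi> i" for i
        using coroot_differential_real[OF chart char\<alpha> assms(6) char[OF \<xi>]] by (simp add: Reals_cnj_iff)
      then have "cnj (differential T \<xi> (?X y)) = (\<Sum>j\<in>UNIV. cnj (y$j) * ?d \<xi> j)"
        by (simp add: dX[OF \<xi>])
      then show "trace (A \<xi>) * (differential T \<xi> (?X y) * cnj (differential T \<xi> (?X y)))
         = (\<Sum>i\<in>UNIV. trace (A \<xi>) * (differential T \<xi> (?X y) * ?d \<xi> i) * cnj (y$i))"
        by (simp add: sum_distrib_left mult_ac)
    qed
    also have "\<dots> = (\<Sum>i\<in>UNIV. (S_matrix T h \<rho> *v y) $ i * cnj (y$i))"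
      unfolding S sum_distrib_right by (rule sum.swap)
    also have "\<dots> = 0" by (simp add: y)
    finally have "differential T \<xi> (?X y) = 0" if "\<xi> \<in> C" for \<xi>
      by (rule definite) (rule that)
    moreover have "finite {t \<in> T. \<rho> t = mat 1}"
      using assms(9) by (rule rev_finite_subset) (use TG in blast)
    ultimately have "?X y = 0" by (intro finite_kernel_differential[OF chart dec _ XT])
    then have "y $ i = 0" for i
      by (rule coroots_independent[OF chart assms(5,6)])
    then show "y = 0" by (simp add: vec_eq_iff)
  qed
  \<comment> \<open>Along \<open>T\<close> the differential of the representation of
    \<open>G\<close> is that of its restriction, which the projectors diagonalise.\<close>
  have dG: "rep_differential G \<rho> X = (\<Sum>\<xi>\<in>C. cscale (differential T \<xi> X) (A \<xi>))"
    if "X \<in> lie_algebra T" for X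
  proof -
    have "rep_differential G \<rho> X = rep_differential T \<rho> X"
      unfolding rep_differential_def using differential_subset[OF G T TG _ that] \<rho>G
      by (simp add: alg_hom_def)
    then show ?thesis by (simp add: rep_differential_eq[OF that])
  qed
  let ?U = "rep_differential G \<rho> ` lie_algebra G"
  have "\<pi> (\<rho> t) \<in> ?U" and perp: "\<rho> t - \<pi> (\<rho> t) \<in> trace_perp ?U"
    using assms(10) by (auto simp: is_projection_def)
  \<comment> \<open>The projection lies in the image of \<open>rep_differential G \<rho>\<close>, so
    applying this map to the preimage chosen by \<open>inv_into\<close> gives the projection
    back.\<close>
  then have \<pi>: "\<pi> (\<rho> t) = rep_differential G \<rho> (?X c)"
    unfolding \<theta>[symmetric] springer_morphism_def by (simp add: f_inv_into_f)
  have "(\<Sum>\<mu>\<in>#weight_mset T \<rho>. weight_coord T h \<mu> i * \<mu> t) = (S_matrix T h \<rho> *v c) $ i" for i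
  proof -
    let ?H = "rep_differential G \<rho> (h i)"
    have "?H \<in> ?U" using hT lie_algebra_mono[OF TG] by blast
    with perp have "trace ((\<rho> t - \<pi> (\<rho> t)) ** ?H) = 0" unfolding trace_perp_def by blast
    then have "trace (\<rho> t ** ?H) = trace (\<pi> (\<rho> t) ** ?H)"
      by (simp add: matrix_diff_left trace_sub)
    \<comment> \<open>Both \<open>\<rho> t\<close> and \<open>?H\<close> are combinations of the
      same projectors, so their product is formed coefficientwise.\<close>
    moreover have "trace (\<rho> t ** ?H) = (\<Sum>\<xi>\<in>C. trace (A \<xi>) * (\<xi> t * ?d \<xi> i))"
      by (simp only: eq[OF t] dG[OF hT] calculus_mult trace_calculus)
    moreover have "trace (\<pi> (\<rho> t) ** ?H) = (S_matrix T h \<rho> *v c) $ i"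
      by (simp only: \<pi> dG[OF hT] dG[OF XT] calculus_mult trace_calculus S)
    ultimately show ?thesis by (simp add: sum_weight_mset weight_coord_def mult_ac)
  qed
  then have eq_c: "(\<chi> i. \<Sum>\<mu>\<in>#weight_mset T \<rho>. weight_coord T h \<mu> i * \<mu> t) = S_matrix T h \<rho> *v c"
    by (simp add: vec_eq_iff)
  show "(\<chi> i. \<Sum>\<mu>\<in>#weight_mset T \<rho>. weight_coord T h \<mu> i * \<mu> t) = S_matrix T h \<rho> *v x \<longleftrightarrow> x = c"
  proof
    assume "(\<chi> i. \<Sum>\<mu>\<in>#weight_mset T \<rho>. weight_coord T h \<mu> i * \<mu> t) = S_matrix T h \<rho> *v x"
    then have "S_matrix T h \<rho> *v (x - c) = 0"
      using eq_c by (simp add: vec.linear_diff[OF matrix_vector_mul_linear_gen])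
    from inj[OF this] show "x = c" by simp
  qed (simp add: eq_c)
qed

end
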